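(* For $i=1,2$ let $f_i:\mathbb{R}^2\to\mathbb{R}_{>0}$ be the bivariate normal density $f_i(\boldsymbol{x})=\phi(\boldsymbol{x};\boldsymbol{\mu}_i,\Sigma_i)$ with mean vector $\boldsymbol{\mu}_i\in\mathbb{R}^2$ and positive definite symmetric $2\times 2$ covariance matrix $\Sigma_i$, and let $F=(f_1,f_2):\mathbb{R}^2\to\mathbb{R}_{>0}^2$. Suppose $\boldsymbol{\mu}_1\neq\boldsymbol{\mu}_2$. Then there are only three $\mathcal{A}$-equivalence classes for such mappings $F$, and one of the following holds: 1. (Type 1) $S(F)$ is a hyperbola. Any point of $S(F)$ is a fold point except for one, and the exceptional point is a cusp. 2. (Type 2) $S(F)$ is two intersecting lines. Any point of $S(F)$ is a fold point except for one (the node, i.e. the intersection point of the two lines), and the singular value set $C(F)$ is a union of a smooth curve and a double point curve. In particular, $F$ is $\mathcal{A}$-equivalent to $(x,y)\mapsto(x,xy^2+y^4)$. 3. (Type 3) $S(F)$ is a line. Any point of $S(F)$ is a fold point. In particular, $F$ is $\mathcal{A}$-equivalent to $(x,y)\mapsto(x,y^2)$.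
   Context: The bivariate normal density is $\phi(\boldsymbol{x};\boldsymbol{\mu},\Sigma)=\frac{1}{2\pi|\Sigma|^{1/2}}\exp\left(-\frac12(\boldsymbol{x}-\boldsymbol{\mu})^T\Sigma^{-1}(\boldsymbol{x}-\boldsymbol{\mu})\right)$, $\boldsymbol{x}=(x,y)\in\mathbb{R}^2$. For a smooth mapping $F$ from $\mathbb{R}^2$ to an open subset of $\mathbb{R}^2$, the singular set is $S(F)=\{\boldsymbol{x}\in\mathbb{R}^2 : \det J_F(\boldsymbol{x})=0\}$, where $J_F$ is the Jacobian matrix, and the singular value set is $C(F)=F(S(F))$. Two smooth mappings $F,G$ are $\mathcal{A}$-equivalent if there are diffeomorphisms $\Phi$ of the source spaces and $\Psi$ of the target spaces with $\Psi\circ F\circ\Phi=G$. Here the target of $F=(f_1,f_2)$ is $\mathbb{R}_{>0}^2$, which is diffeomorphic to $\mathbb{R}^2$ (e.g. via $(X,Y)\mapsto(\log X,\log Y)$); so when $F$ is compared with a mapping into $\mathbb{R}^2$, $\Psi$ is a diffeomorphism $\mathbb{R}_{>0}^2\to\mathbb{R}^2$. A point $\boldsymbol{x}_0\in\mathbb{R}^2$ is a fold point (resp. a cusp) of $F$ if, after smooth local coordinate changes of the source around $\boldsymbol{x}_0$ and of the target around $F(\boldsymbol{x}_0)$, $F$ is locally expressed as $(x,y)\mapsto(x,y^2)$ (resp. $(x,y)\mapsto(x,xy+y^3)$) at the origin. A double point curve means a curve traced twice by its parametrization; the model is $y\mapsto(-2y^2,y^4)$, $y\in\mathbb{R}$,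 which together with the smooth curve $x\mapsto(x,0)$ forms the singular value set of $(x,y)\mapsto(x,xy^2+y^4)$. *)

theory Defs
  imports "HOL-Analysis.Analysis"
begin

section \<open>Smooth maps and diffeomorphisms\<close>

text \<open>These two notions are meant for open \<open>S\<close>; on an open set, \<open>smooth_on S f\<close> is
  \<open>C\<^sup>\<infinity>\<close>: all iterated directional derivatives exist and are Frechet differentiable.\<close>

primrec higher_differentiable_on ::
    "'a::real_normed_vector set \<Rightarrow> ('a \<Rightarrow> 'b::real_normed_vector) \<Rightarrow> nat \<Rightarrow> bool" where
  "higher_differentiable_on S f 0 \<longleftrightarrow> continuous_on S f"
| "higher_differentiable_on S f (Suc n) \<longleftrightarrow>
     (\<forall>x\<in>S. f differentiable (at x)) \<and>
     (\<forall>v. higher_differentiable_on S (\<lambda>x. frechet_derivative f (at x) v) n)"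

definition smooth_on :: "'a::real_normed_vector set \<Rightarrow> ('a \<Rightarrow> 'b::real_normed_vector) \<Rightarrow> bool" where
  "smooth_on S f \<longleftrightarrow> (\<forall>n. higher_differentiable_on S f n)"

definition smooth_map ::
    "'a::real_normed_vector set \<Rightarrow> 'b::real_normed_vector set \<Rightarrow> ('a \<Rightarrow> 'b) \<Rightarrow> bool" where
  "smooth_map U V f \<longleftrightarrow> smooth_on U f \<and> f ` U \<subseteq> V"

definition diffeomorphism ::
    "'a::real_normed_vector set \<Rightarrow> 'b::real_normed_vector set \<Rightarrow> ('a \<Rightarrow> 'b) \<Rightarrow> bool" where
  "diffeomorphism U V f \<longleftrightarrow> open U \<and> open V \<and>
     (\<exists>g. homeomorphism U V f g \<and> smooth_on U f \<and> smooth_on V g)"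

definition A_equivalent ::
    "'a::real_normed_vector set \<Rightarrow> 'b::real_normed_vector set \<Rightarrow> ('a \<Rightarrow> 'b) \<Rightarrow>
     'c::real_normed_vector set \<Rightarrow> 'd::real_normed_vector set \<Rightarrow> ('c \<Rightarrow> 'd) \<Rightarrow> bool" where
  "A_equivalent U V F U' V' G \<longleftrightarrow> smooth_map U V F \<and> smooth_map U' V' G \<and>
     (\<exists>\<Phi> \<Psi>. diffeomorphism U' U \<Phi> \<and> diffeomorphism V V' \<Psi> \<and>
            (\<forall>x\<in>U'. \<Psi> (F (\<Phi> x)) = G x))"

text \<open>The germ of \<open>F\<close> at \<open>x0\<close> is expressed as the germ of \<open>G\<close> at \<open>y0\<close> in suitable smooth local
  coordinates.\<close>

definition germ_A_equivalent ::
    "('a::real_normed_vector \<Rightarrow> 'b::real_normed_vector) \<Rightarrow> 'a \<Rightarrow>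
     ('c::real_normed_vector \<Rightarrow> 'd::real_normed_vector) \<Rightarrow> 'c \<Rightarrow> bool" where
  "germ_A_equivalent F x0 G y0 \<longleftrightarrow>
     (\<exists>U V U' V' \<Phi> \<Psi>. x0 \<in> U \<and> y0 \<in> U' \<and> F ` U \<subseteq> V \<and>
        diffeomorphism U' U \<Phi> \<and> diffeomorphism V V' \<Psi> \<and>
        \<Phi> y0 = x0 \<and> \<Psi> (F x0) = G y0 \<and> (\<forall>x\<in>U'. \<Psi> (F (\<Phi> x)) = G x))"

section \<open>Singularities of plane-to-plane maps\<close>

definition singular_set :: "(real^2 \<Rightarrow> real^2) \<Rightarrow> (real^2) set" where
  "singular_set F = {x. det (jacobian F (at x)) = 0}"

definition singular_value_set :: "(real^2 \<Rightarrow> real^2) \<Rightarrow> (real^2) set" where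
  "singular_value_set F = F ` singular_set F"

definition fold_model :: "real^2 \<Rightarrow> real^2" where
  "fold_model z = vector [z$1, (z$2)^2]"

definition cusp_model :: "real^2 \<Rightarrow> real^2" where
  "cusp_model z = vector [z$1, z$1 * z$2 + (z$2)^3]"

definition node_model :: "real^2 \<Rightarrow> real^2" where
  "node_model z = vector [z$1, z$1 * (z$2)^2 + (z$2)^4]"

definition fold_point :: "(real^2 \<Rightarrow> real^2) \<Rightarrow> real^2 \<Rightarrow> bool" where
  "fold_point F x0 \<longleftrightarrow> germ_A_equivalent F x0 fold_model 0"

definition cusp_point :: "(real^2 \<Rightarrow> real^2) \<Rightarrow> real^2 \<Rightarrow> bool" where
  "cusp_point F x0 \<longleftrightarrow> germ_A_equivalent F x0 cusp_model 0"

section \<open>Plane curves\<close>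

definition is_line :: "(real^2) set \<Rightarrow> bool" where
  "is_line L \<longleftrightarrow> (\<exists>a b. a \<noteq> b \<and> L = affine hull {a, b})"

text \<open>Standard equation of a hyperbola with centre \<open>c\<close> and semi-axes \<open>a\<close>, \<open>b\<close> along the
  orthonormal basis \<open>u\<close>, \<open>v\<close>.\<close>

definition is_hyperbola :: "(real^2) set \<Rightarrow> bool" where
  "is_hyperbola H \<longleftrightarrow>
     (\<exists>c u v a b. norm u = 1 \<and> norm v = 1 \<and> u \<bullet> v = 0 \<and> a > 0 \<and> b > 0 \<and>
        H = {x. (((x - c) \<bullet> u) / a)^2 - (((x - c) \<bullet> v) / b)^2 = 1})"

text \<open>A smooth curve: a smooth embedding of the real line.\<close>

definition smooth_curve :: "(real \<Rightarrow> real^2) \<Rightarrow> bool" where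
  "smooth_curve \<gamma> \<longleftrightarrow> smooth_on UNIV \<gamma> \<and> (\<forall>t. vector_derivative \<gamma> (at t) \<noteq> 0) \<and>
     (\<exists>g. homeomorphism UNIV (range \<gamma>) \<gamma> g)"

text \<open>A curve traced twice by its parametrization, as in the model \<open>y \<mapsto> (-2 y\<^sup>2, y\<^sup>4)\<close>: the
  parameters \<open>t\<close> and \<open>-t\<close> give the same point, each half traces the image once, and the
  parametrization is regular except at the turning point \<open>t = 0\<close> (where evenness forces the
  velocity to vanish).\<close>

definition double_point_curve :: "(real \<Rightarrow> real^2) \<Rightarrow> bool" where
  "double_point_curve \<delta> \<longleftrightarrow> smooth_on UNIV \<delta> \<and> (\<forall>t. \<delta> (- t) = \<delta> t) \<and>
     (\<forall>t. t \<noteq> 0 \<longrightarrow> vector_derivative \<delta> (at t) \<noteq> 0) \<and>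
     (\<exists>g. homeomorphism {0..} (range \<delta>) \<delta> g)"

section \<open>Pairs of bivariate normal densities\<close>

definition pos_def_sym :: "real^2^2 \<Rightarrow> bool" where
  "pos_def_sym A \<longleftrightarrow> transpose A = A \<and> (\<forall>v. v \<noteq> 0 \<longrightarrow> v \<bullet> (A *v v) > 0)"

definition binormal_density :: "real^2 \<Rightarrow> real^2^2 \<Rightarrow> real^2 \<Rightarrow> real" where
  "binormal_density \<mu> \<Sigma> x =
     1 / (2 * pi * sqrt (det \<Sigma>)) * exp (- (1/2) * ((x - \<mu>) \<bullet> (matrix_inv \<Sigma> *v (x - \<mu>))))"

definition binormal_pair :: "real^2 \<Rightarrow> real^2^2 \<Rightarrow> real^2 \<Rightarrow> real^2^2 \<Rightarrow> real^2 \<Rightarrow> real^2" where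
  "binormal_pair \<mu>1 \<Sigma>1 \<mu>2 \<Sigma>2 x = vector [binormal_density \<mu>1 \<Sigma>1 x, binormal_density \<mu>2 \<Sigma>2 x]"

definition pos_quadrant :: "(real^2) set" where
  "pos_quadrant = {z. z$1 > 0 \<and> z$2 > 0}"

definition binormal_pairs :: "(real^2 \<Rightarrow> real^2) set" where
  "binormal_pairs = {binormal_pair \<mu>1 \<Sigma>1 \<mu>2 \<Sigma>2 | \<mu>1 \<Sigma>1 \<mu>2 \<Sigma>2.
     pos_def_sym \<Sigma>1 \<and> pos_def_sym \<Sigma>2 \<and> \<mu>1 \<noteq> \<mu>2}"

definition A_rel :: "((real^2 \<Rightarrow> real^2) \<times> (real^2 \<Rightarrow> real^2)) set" where
  "A_rel = {(F, G). F \<in> binormal_pairs \<and> G \<in> binormal_pairs \<and>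
     A_equivalent UNIV pos_quadrant F UNIV pos_quadrant G}"

section \<open>The three types\<close>

definition type1 :: "(real^2 \<Rightarrow> real^2) \<Rightarrow> bool" where
  "type1 F \<longleftrightarrow> is_hyperbola (singular_set F) \<and>
     (\<exists>p. {x \<in> singular_set F. \<not> fold_point F x} = {p} \<and> cusp_point F p)"

text \<open>In Type 2 the two curves making up the singular value set are traced by \<open>F\<close> along regular
  parametrizations \<open>\<alpha>\<close>, \<open>\<beta>\<close> of the two lines.\<close>

definition type2 :: "(real^2 \<Rightarrow> real^2) \<Rightarrow> bool" where
  "type2 F \<longleftrightarrow>
     (\<exists>L1 L2 p. is_line L1 \<and> is_line L2 \<and> L1 \<inter> L2 = {p} \<and> singular_set F = L1 \<union> L2 \<and>
        {x \<in> singular_set F. \<not> fold_point F x} = {p} \<and>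
        (\<exists>\<alpha> \<beta>. smooth_curve \<alpha> \<and> range \<alpha> = L1 \<and> smooth_curve \<beta> \<and> range \<beta> = L2 \<and>
           smooth_curve (F \<circ> \<alpha>) \<and> double_point_curve (F \<circ> \<beta>) \<and>
           singular_value_set F = range (F \<circ> \<alpha>) \<union> range (F \<circ> \<beta>))) \<and>
     A_equivalent UNIV pos_quadrant F UNIV UNIV node_model"

definition type3 :: "(real^2 \<Rightarrow> real^2) \<Rightarrow> bool" where
  "type3 F \<longleftrightarrow> is_line (singular_set F) \<and> (\<forall>x\<in>singular_set F. fold_point F x) \<and>
     A_equivalent UNIV pos_quadrant F UNIV UNIV fold_model"

end

theory Submission
  imports Defs
begin

text \<open>Taking logarithms in the target turns a pair of normal densities into a pair of quadratic
  functions. Diagonalising the pencil spanned by their quadratic parts brings the pair, by affine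
  changes of the source and of the target, to \<open>(x\<^sup>2 + y, y\<^sup>2 + x)\<close>, to \<open>(x\<^sup>2, y\<^sup>2 + x)\<close> or,
  if the quadratic parts are proportional, to \<open>(x, y\<^sup>2)\<close> after a further quadratic change of the
  target. Hence there are at most three classes. They are told apart by the largest number of
  preimages that can accumulate at a single point: three, four and two respectively.\<close>

section \<open>Calculus of smooth maps\<close>

text \<open>Let A and B be the inverse covariance matrices. If they are not proportional, det (B - l
  A) has roots l1 < l2, and the quadratic parts of Q2 - l1 Q1 and l2 Q1 - Q2 are squares of
  independent linear forms. Completing these squares leaves one linear cross term in each
  combination. The two cross coefficients vanish together only if the means coincide; otherwise both
  survive (cusp case) or exactly one does (node case). Changes of the source have to be affine
  because diffeomorphisms do not preserve lines and hyperbolas. No general recognition criterion for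
  folds and cusps is involved: along a kernel line a quadratic map has no linear term, which makes
  fold coordinates explicit, and cusp coordinates come from the resolvent cubic of a quartic.
  Preimages are counted near a point because the global count fails: \<open>cusp_form\<close>, like
  \<open>node_form\<close>, has values with four preimages. The types are not visibly invariant
  under equivalence; they become so by matching each of them with one normal form.\<close>

lemma higher_differentiable_on_cong:
  assumes "open S" "\<And>x. x \<in> S \<Longrightarrow> f x = g x" "higher_differentiable_on S f n"
  shows "higher_differentiable_on S g n"
  using assms(2,3)
proof (induction n arbitrary: f g)
  case 0
  then show ?case by (simp cong: continuous_on_cong)
next
  case (Suc n)
  have der: "(g has_derivative frechet_derivative f (at x)) (at x)" if "x \<in> S" for x
    using Suc.prems that assms(1)
    by (intro has_derivative_transform_within_open[of f _ x UNIV S g])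
      (auto simp: frechet_derivative_works)
  show ?case
    unfolding higher_differentiable_on.simps
  proof (intro conjI ballI allI)
    fix x assume "x \<in> S"
    then show "g differentiable (at x)" using der by (auto simp: differentiable_def)
  next
    fix v
    show "higher_differentiable_on S (\<lambda>x. frechet_derivative g (at x) v) n"
    proof (rule Suc.IH)
      show "frechet_derivative f (at x) v = frechet_derivative g (at x) v" if "x \<in> S" for x
        using frechet_derivative_at[OF der[OF that]] by simp
      show "higher_differentiable_on S (\<lambda>x. frechet_derivative f (at x) v) n"
        using Suc.prems(2) by simp
    qed
  qed
qed

text \<open>Lets an induction on the order work with an explicit derivative in place of
  \<open>frechet_derivative\<close>.\<close>

lemma higher_differentiable_on_SucI:
  assumes "open S" "\<And>x. x \<in> S \<Longrightarrow> (f has_derivative f' x) (at x)"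
    "\<And>v. higher_differentiable_on S (\<lambda>x. f' x v) n"
  shows "higher_differentiable_on S f (Suc n)"
  unfolding higher_differentiable_on.simps
proof (intro conjI ballI allI)
  show "f differentiable (at x)" if "x \<in> S" for x
    using assms(2)[OF that] by (auto simp: differentiable_def)
  show "higher_differentiable_on S (\<lambda>x. frechet_derivative f (at x) v) n" for v
    by (rule higher_differentiable_on_cong[OF assms(1) _ assms(3)[of v]])
      (simp add: frechet_derivative_at[OF assms(2), symmetric])
qed

lemma higher_differentiable_on_Suc_has_derivative:
  assumes "higher_differentiable_on S f (Suc n)" "x \<in> S"
  shows "(f has_derivative frechet_derivative f (at x)) (at x)"
  using assms by (auto simp: frechet_derivative_works)

lemma higher_differentiable_on_SucD:
  "higher_differentiable_on S f (Suc n) \<Longrightarrow> higher_differentiable_on S f n"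
proof (induction n arbitrary: f)
  case 0
  then show ?case
    by (auto intro!: continuous_at_imp_continuous_on differentiable_imp_continuous_within)
qed auto

lemma higher_differentiable_on_subset:
  assumes "higher_differentiable_on S f n" "T \<subseteq> S"
  shows "higher_differentiable_on T f n"
  using assms by (induction n arbitrary: f) (auto intro: continuous_on_subset)

lemma higher_differentiable_on_const: "higher_differentiable_on S (\<lambda>x. c) n"
  by (induction n arbitrary: c) auto

lemma higher_differentiable_on_bounded_linear:
  assumes "bounded_linear L" "open S"
  shows "higher_differentiable_on S L n"
proof (cases n)
  case 0
  then show ?thesis using assms by (simp add: linear_continuous_on)
next
  case (Suc m)
  show ?thesis unfolding Suc
    by (rule higher_differentiable_on_SucI[of S L "\<lambda>x. L"])
      (auto intro: assms higher_differentiable_on_const bounded_linear_imp_has_derivative)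
qed

lemma higher_differentiable_on_add:
  assumes "open S" "higher_differentiable_on S f n" "higher_differentiable_on S g n"
  shows "higher_differentiable_on S (\<lambda>x. f x + g x) n"
  using assms(2,3)
proof (induction n arbitrary: f g)
  case 0
  then show ?case by (auto intro: continuous_on_add)
next
  case (Suc n)
  show ?case
    by (rule higher_differentiable_on_SucI[OF assms(1)],
        rule has_derivative_add[OF Suc.prems[THEN higher_differentiable_on_Suc_has_derivative]])
      (use Suc in auto)
qed

text \<open>The product rule gives a sum of two terms of the same bilinear shape, each with one
  factor differentiated; the other factor only has to be lowered by one order, so the induction
  closes.\<close>

lemma higher_differentiable_on_bilinear:
  assumes "bounded_bilinear p" "open S"
    "higher_differentiable_on S f n" "higher_differentiable_on S g n"
  shows "higher_differentiable_on S (\<lambda>x. p (f x) (g x)) n"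
  using assms(3,4)
proof (induction n arbitrary: f g)
  case 0
  then show ?case by (auto intro: bounded_bilinear.continuous_on[OF assms(1)])
next
  case (Suc n)
  show ?case
    by (rule higher_differentiable_on_SucI[OF assms(2)],
        rule bounded_bilinear.FDERIV[OF assms(1)
          Suc.prems[THEN higher_differentiable_on_Suc_has_derivative]])
      (use Suc higher_differentiable_on_SucD[OF Suc.prems(1)]
         higher_differentiable_on_SucD[OF Suc.prems(2)]
       in \<open>auto intro!: higher_differentiable_on_add assms\<close>)
qed

lemmas higher_differentiable_on_scaleR =
  higher_differentiable_on_bilinear[OF bounded_bilinear_scaleR]

lemmas higher_differentiable_on_mult =
  higher_differentiable_on_bilinear[OF bounded_bilinear_mult]

lemma higher_differentiable_on_sum:
  assumes "open S" "finite I" "\<And>i. i \<in> I \<Longrightarrow> higher_differentiable_on S (f i) n"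
  shows "higher_differentiable_on S (\<lambda>x. \<Sum>i\<in>I. f i x) n"
  using assms(2,3)
  by (induction I rule: finite_induct)
    (auto intro: higher_differentiable_on_const higher_differentiable_on_add[OF assms(1)])

text \<open>The chain rule derivative applies \<open>?f' (g x)\<close> to a vector that itself
  varies with x, so it is not a composition with a fixed function. Expanding that vector in a basis
  yields scalar functions times compositions with the fixed directional derivatives of
  \<open>f\<close>, to which the induction hypothesis applies.\<close>

lemma higher_differentiable_on_compose:
  fixes f :: "'b::euclidean_space \<Rightarrow> 'c::real_normed_vector" and g :: "'a::real_normed_vector \<Rightarrow> 'b"
  assumes "open S" "open T" "g ` S \<subseteq> T"
    "higher_differentiable_on T f n" "higher_differentiable_on S g n"
  shows "higher_differentiable_on S (\<lambda>x. f (g x)) n"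
  using assms(4,5)
proof (induction n arbitrary: f)
  case 0
  then show ?case using assms(3) by (auto intro: continuous_on_compose2)
next
  case (Suc n)
  let ?f' = "\<lambda>y. frechet_derivative f (at y)" and ?g' = "\<lambda>x. frechet_derivative g (at x)"
  have expand: "?f' y w = (\<Sum>i\<in>Basis. (w \<bullet> i) *\<^sub>R ?f' y i)" if "y \<in> T" for y w
  proof -
    have "linear (?f' y)"
      using Suc.prems(1) that by (auto intro: linear_frechet_derivative)
    then have "?f' y (\<Sum>i\<in>Basis. (w \<bullet> i) *\<^sub>R i) = (\<Sum>i\<in>Basis. (w \<bullet> i) *\<^sub>R ?f' y i)"
      by (simp add: linear_sum linear_scale)
    then show ?thesis by (simp add: euclidean_representation)
  qed
  show ?case
  proof (rule higher_differentiable_on_SucI[OF assms(1)])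
    fix x assume x: "x \<in> S"
    have "((f \<circ> g) has_derivative (?f' (g x) \<circ> ?g' x)) (at x)"
      using x assms(3)
      by (intro diff_chain_at higher_differentiable_on_Suc_has_derivative[OF Suc.prems(1)]
          higher_differentiable_on_Suc_has_derivative[OF Suc.prems(2)]) auto
    moreover have "?f' (g x) \<circ> ?g' x = (\<lambda>v. \<Sum>i\<in>Basis. (?g' x v \<bullet> i) *\<^sub>R ?f' (g x) i)"
      using expand[of "g x"] x assms(3) by (auto simp: fun_eq_iff)
    ultimately show "((\<lambda>x. f (g x)) has_derivative
        (\<lambda>v. \<Sum>i\<in>Basis. (?g' x v \<bullet> i) *\<^sub>R ?f' (g x) i)) (at x)"
      by (simp add: comp_def)
  next
    fix v
    have g': "higher_differentiable_on S (\<lambda>x. ?g' x v) n"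
      using Suc.prems by simp
    show "higher_differentiable_on S (\<lambda>x. \<Sum>i\<in>Basis. (?g' x v \<bullet> i) *\<^sub>R ?f' (g x) i) n"
      using Suc.prems(1)
      by (intro higher_differentiable_on_sum higher_differentiable_on_scaleR finite_Basis assms(1)
          higher_differentiable_on_bilinear[OF bounded_bilinear_inner assms(1) g']
          higher_differentiable_on_const Suc.IH higher_differentiable_on_SucD[OF Suc.prems(2)]) simp
  qed
qed

lemma smooth_on_cong:
  "open S \<Longrightarrow> (\<And>x. x \<in> S \<Longrightarrow> f x = g x) \<Longrightarrow> smooth_on S f \<Longrightarrow> smooth_on S g"
  unfolding smooth_on_def using higher_differentiable_on_cong by blast

lemma smooth_on_subset: "smooth_on S f \<Longrightarrow> T \<subseteq> S \<Longrightarrow> smooth_on T f"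
  unfolding smooth_on_def using higher_differentiable_on_subset by blast

lemma smooth_on_has_derivative:
  assumes "smooth_on S f" "x \<in> S"
  shows "(f has_derivative frechet_derivative f (at x)) (at x)"
  using assms higher_differentiable_on_Suc_has_derivative unfolding smooth_on_def by blast

lemma smooth_on_imp_continuous_on: "smooth_on S f \<Longrightarrow> continuous_on S f"
  unfolding smooth_on_def using higher_differentiable_on.simps(1) by blast

lemma smooth_on_bounded_linear: "bounded_linear L \<Longrightarrow> open S \<Longrightarrow> smooth_on S L"
  by (simp add: smooth_on_def higher_differentiable_on_bounded_linear)

lemma smooth_on_compose:
  fixes f :: "'b::euclidean_space \<Rightarrow> 'c::real_normed_vector" and g :: "'a::real_normed_vector \<Rightarrow> 'b"
  assumes "open S" "open T" "g ` S \<subseteq> T" "smooth_on T f" "smooth_on S g"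
  shows "smooth_on S (\<lambda>x. f (g x))"
  using assms unfolding smooth_on_def by (blast intro: higher_differentiable_on_compose)

section \<open>Closure rules for smooth functions\<close>

named_theorems smooth_intros

lemma smooth_on_const [smooth_intros]: "smooth_on S (\<lambda>x. c)"
  by (simp add: smooth_on_def higher_differentiable_on_const)

lemma smooth_on_id [smooth_intros]: "open S \<Longrightarrow> smooth_on S (\<lambda>x. x)"
  by (rule smooth_on_bounded_linear) (rule bounded_linear_ident)

lemma smooth_on_vec_nth [smooth_intros]: "open S \<Longrightarrow> smooth_on S (\<lambda>x::real^'n. x $ i)"
  by (rule smooth_on_bounded_linear) (rule bounded_linear_vec_nth)

lemma smooth_on_add [smooth_intros]:
  "open S \<Longrightarrow> smooth_on S f \<Longrightarrow> smooth_on S g \<Longrightarrow> smooth_on S (\<lambda>x. f x + g x)"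
  by (simp add: smooth_on_def higher_differentiable_on_add)

lemma smooth_on_scaleR [smooth_intros]:
  "open S \<Longrightarrow> smooth_on S f \<Longrightarrow> smooth_on S g \<Longrightarrow> smooth_on S (\<lambda>x. f x *\<^sub>R g x)"
  by (simp add: smooth_on_def higher_differentiable_on_scaleR)

lemma smooth_on_mult [smooth_intros]:
  fixes f g :: "_ \<Rightarrow> real"
  shows "open S \<Longrightarrow> smooth_on S f \<Longrightarrow> smooth_on S g \<Longrightarrow> smooth_on S (\<lambda>x. f x * g x)"
  by (simp add: smooth_on_def higher_differentiable_on_mult)

lemma smooth_on_uminus [smooth_intros]:
  "open S \<Longrightarrow> smooth_on S f \<Longrightarrow> smooth_on S (\<lambda>x. - f x)"
  using smooth_on_scaleR[OF _ smooth_on_const[of S "-1"], of f] by simp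

lemma smooth_on_diff [smooth_intros]:
  "open S \<Longrightarrow> smooth_on S f \<Longrightarrow> smooth_on S g \<Longrightarrow> smooth_on S (\<lambda>x. f x - g x)"
  using smooth_on_add[OF _ _ smooth_on_uminus, of S f g] by simp

lemma smooth_on_power [smooth_intros]:
  fixes f :: "_ \<Rightarrow> real"
  shows "open S \<Longrightarrow> smooth_on S f \<Longrightarrow> smooth_on S (\<lambda>x. f x ^ n)"
  by (induction n) (simp_all add: smooth_on_const smooth_on_mult)

lemma vector_2_conv: "(vector [a, b] :: real^2) = a *\<^sub>R axis 1 1 + b *\<^sub>R axis 2 1"
  by (simp add: vec_eq_iff forall_2 axis_def)

lemma smooth_on_vector_2 [smooth_intros]:
  "open S \<Longrightarrow> smooth_on S f \<Longrightarrow> smooth_on S g \<Longrightarrow> smooth_on S (\<lambda>x. vector [f x, g x] :: real^2)"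
  unfolding vector_2_conv by (intro smooth_intros)

lemma smooth_on_component:
  fixes f :: "'a::real_normed_vector \<Rightarrow> real^'n"
  assumes "open S" "smooth_on S f"
  shows "smooth_on S (\<lambda>x. f x $ i)"
  by (rule smooth_on_compose[OF assms(1) open_UNIV _ smooth_on_vec_nth[OF open_UNIV] assms(2)]) simp

lemma smooth_on_exp [smooth_intros]:
  fixes f :: "_ \<Rightarrow> real"
  assumes "open S" "smooth_on S f"
  shows "smooth_on S (\<lambda>x. exp (f x))"
proof -
  have "higher_differentiable_on UNIV (exp :: real \<Rightarrow> real) n" for n
  proof (induction n)
    case 0
    then show ?case by (auto intro: continuous_intros)
  next
    case (Suc n)
    show ?case
      by (rule higher_differentiable_on_SucI[of _ _ "\<lambda>x v. v * exp x"])
        (auto intro!: derivative_eq_intros higher_differentiable_on_mult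
          higher_differentiable_on_const Suc)
  qed
  then show ?thesis
    by (intro smooth_on_compose[OF assms(1) open_UNIV _ _ assms(2)]) (auto simp: smooth_on_def)
qed

lemma open_nonzero_reals: "open {x::real. x \<noteq> 0}"
  by (intro open_Collect_neq continuous_intros)

lemma smooth_on_inverse [smooth_intros]:
  fixes f :: "_ \<Rightarrow> real"
  assumes "open S" "smooth_on S f" "\<And>x. x \<in> S \<Longrightarrow> f x \<noteq> 0"
  shows "smooth_on S (\<lambda>x. inverse (f x))"
proof -
  have "higher_differentiable_on {x. x \<noteq> 0} (inverse :: real \<Rightarrow> real) n" for n
  proof (induction n)
    case 0
    then show ?case by (auto intro: continuous_intros)
  next
    case (Suc n)
    show ?case
    proof (rule higher_differentiable_on_SucI[of _ _ "\<lambda>x v. (- v) * (inverse x * inverse x)"])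
      show "higher_differentiable_on {x::real. x \<noteq> 0} (\<lambda>x. (- v) * (inverse x * inverse x)) n" for v
        by (intro higher_differentiable_on_mult open_nonzero_reals higher_differentiable_on_const Suc)
    qed (auto intro!: derivative_eq_intros open_nonzero_reals)
  qed
  then show ?thesis
    using assms(3)
    by (intro smooth_on_compose[OF assms(1) open_nonzero_reals _ _ assms(2)])
      (auto simp: smooth_on_def)
qed

lemma smooth_on_divide [smooth_intros]:
  fixes f :: "_ \<Rightarrow> real"
  assumes "open S" "smooth_on S f" "smooth_on S g" "\<And>x. x \<in> S \<Longrightarrow> g x \<noteq> 0"
  shows "smooth_on S (\<lambda>x. f x / g x)"
  unfolding divide_inverse using assms by (intro smooth_intros)

lemma smooth_on_ln [smooth_intros]:
  fixes f :: "_ \<Rightarrow> real"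
  assumes "open S" "smooth_on S f" "\<And>x. x \<in> S \<Longrightarrow> f x > 0"
  shows "smooth_on S (\<lambda>x. ln (f x))"
proof -
  have "higher_differentiable_on {0<..} (ln :: real \<Rightarrow> real) n" for n
  proof (cases n)
    case 0
    then show ?thesis by (auto intro!: continuous_intros)
  next
    case (Suc m)
    have "smooth_on {0<..} (\<lambda>x::real. v * inverse x)" for v
      by (intro smooth_intros) auto
    then show ?thesis unfolding Suc
      by (intro higher_differentiable_on_SucI[of _ _ "\<lambda>x v. v * inverse x"])
        (auto intro!: derivative_eq_intros simp: smooth_on_def divide_inverse)
  qed
  then show ?thesis
    using assms(3)
    by (intro smooth_on_compose[OF assms(1) open_greaterThan _ _ assms(2)])
      (auto simp: smooth_on_def)
qed

section \<open>Diffeomorphisms\<close>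

lemma diffeomorphismI:
  assumes "open U" "open V" "smooth_on U f" "smooth_on V g" "f ` U \<subseteq> V" "g ` V \<subseteq> U"
    "\<And>x. x \<in> U \<Longrightarrow> g (f x) = x" "\<And>y. y \<in> V \<Longrightarrow> f (g y) = y"
  shows "diffeomorphism U V f"
  unfolding diffeomorphism_def
  using assms by (metis homeomorphismI smooth_on_imp_continuous_on)

text \<open>Trades the existentially bound inverse for the concrete \<open>inv_into U f\<close>,
  which later constructions can name.\<close>

lemma
  assumes "diffeomorphism U V f"
  shows diffeomorphism_open: "open U" "open V"
    and diffeomorphism_smooth: "smooth_on U f"
    and diffeomorphism_image: "f ` U = V"
    and diffeomorphism_inj_on: "inj_on f U"
    and diffeomorphism_homeomorphism: "homeomorphism U V f (inv_into U f)"
    and diffeomorphism_inverse: "diffeomorphism V U (inv_into U f)"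
proof -
  obtain g where g: "homeomorphism U V f g" "smooth_on U f" "smooth_on V g" and open_UV: "open U" "open V"
    using assms unfolding diffeomorphism_def by blast
  show "open U" "open V" "smooth_on U f" by fact+
  show im: "f ` U = V" and inj: "inj_on f U"
    using g(1) by (auto simp: homeomorphism_def intro: inj_on_inverseI)
  have eq: "g y = inv_into U f y" if "y \<in> V" for y
    using g(1) inj that by (auto simp: homeomorphism_def intro: inv_into_f_eq[symmetric])
  then show hom: "homeomorphism U V f (inv_into U f)"
    using g(1) by (auto intro: homeomorphism_cong)
  show "diffeomorphism V U (inv_into U f)"
    unfolding diffeomorphism_def
    using homeomorphism_symD[OF hom] open_UV g(2) smooth_on_cong[OF open_UV(2) eq g(3)] by auto
qed

lemma diffeomorphism_restrict:
  assumes f: "diffeomorphism U V f" and W: "open W" "W \<subseteq> U"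
  shows "diffeomorphism W (f ` W) f"
proof -
  have "openin (top_of_set V) (f ` W)"
    using homeomorphism_imp_open_map[OF diffeomorphism_homeomorphism[OF f]] W
    by (simp add: open_subset)
  then have "open (f ` W)"
    using diffeomorphism_open(2)[OF f] openin_open_trans by blast
  moreover have "f ` W \<subseteq> V"
    using diffeomorphism_image[OF f] W(2) by blast
  moreover have "inv_into U f (f x) = x" if "x \<in> W" for x
    using diffeomorphism_inj_on[OF f] W(2) that by (auto intro: inv_into_f_f)
  ultimately show ?thesis
    using W smooth_on_subset[OF diffeomorphism_smooth[OF f]]
      smooth_on_subset[OF diffeomorphism_smooth[OF diffeomorphism_inverse[OF f]]]
    by (intro diffeomorphismI[where g = "inv_into U f"]) auto
qed

lemma diffeomorphism_compose:
  fixes f :: "'a::euclidean_space \<Rightarrow> 'b::euclidean_space" and g :: "'b \<Rightarrow> 'c::euclidean_space"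
  assumes f: "diffeomorphism U V f" and g: "diffeomorphism V W g"
  shows "diffeomorphism U W (\<lambda>x. g (f x))"
proof -
  have "homeomorphism U W (g \<circ> f) (inv_into U f \<circ> inv_into V g)"
    by (rule homeomorphism_compose[OF f[THEN diffeomorphism_homeomorphism]
          g[THEN diffeomorphism_homeomorphism]])
  moreover have "smooth_on U (\<lambda>x. g (f x))"
    using f g by (intro smooth_on_compose[of U V f g])
      (auto dest: diffeomorphism_open diffeomorphism_image diffeomorphism_smooth)
  moreover have "smooth_on W (\<lambda>x. inv_into U f (inv_into V g x))"
    using f[THEN diffeomorphism_inverse] g[THEN diffeomorphism_inverse]
    by (intro smooth_on_compose[of W V "inv_into V g" "inv_into U f"])
      (auto dest: diffeomorphism_open diffeomorphism_image diffeomorphism_smooth)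
  ultimately show ?thesis
    using diffeomorphism_open[OF f] diffeomorphism_open[OF g]
    unfolding diffeomorphism_def comp_def by blast
qed

text \<open>By Cramer's rule the derivative of the inverse is a rational expression in the partial
  derivatives of \<open>f\<close>, evaluated at \<open>g\<close>; this gains one order of differentiability at a time.\<close>

lemma smooth_on_inverse_function:
  fixes f g :: "real^2 \<Rightarrow> real^2"
  assumes U: "open U" and V: "open V" and f: "smooth_on U f" and hom: "homeomorphism U V f g"
    and g': "\<And>y. y \<in> V \<Longrightarrow> (g has_derivative g' y) (at y)"
  shows "smooth_on V g"
proof -
  define c1 where "c1 = (\<lambda>x. frechet_derivative f (at x) (axis 1 1))"
  define c2 where "c2 = (\<lambda>x. frechet_derivative f (at x) (axis 2 1))"
  define D where "D = (\<lambda>x. c1 x $ 1 * c2 x $ 2 - c1 x $ 2 * c2 x $ 1)"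
  define H :: "real^2 \<Rightarrow> real^2 \<Rightarrow> real^2" where "H = (\<lambda>v x. vector
    [(v $ 1 * c2 x $ 2 - v $ 2 * c2 x $ 1) / D x, (v $ 2 * c1 x $ 1 - v $ 1 * c1 x $ 2) / D x])"
  define U' where "U' = {x \<in> U. D x \<noteq> 0}"
  have c: "smooth_on U c1" "smooth_on U c2"
    using f higher_differentiable_on.simps(2)[of U f] unfolding c1_def c2_def smooth_on_def by blast+
  have D: "smooth_on U D"
    unfolding D_def by (intro smooth_intros smooth_on_component U c)
  have U': "open U'"
  proof -
    have "U' = U \<inter> D -` {x. x \<noteq> 0}" by (auto simp: U'_def)
    then show ?thesis
      using continuous_open_preimage[OF smooth_on_imp_continuous_on[OF D] U open_nonzero_reals]
      by simp
  qed
  have H: "smooth_on U' (H v)" for v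
    unfolding H_def
    by (intro smooth_intros smooth_on_component U' c[THEN smooth_on_subset] D[THEN smooth_on_subset])
      (auto simp: U'_def)
  have inverse: "D (g y) \<noteq> 0 \<and> g' y v = H v (g y)" if y: "y \<in> V" for y v
  proof -
    have gy: "g y \<in> U" using hom y unfolding homeomorphism_def by blast
    have lin: "linear (frechet_derivative f (at (g y)))"
      using smooth_on_has_derivative[OF f gy] has_derivative_linear by blast
    have expand: "frechet_derivative f (at (g y)) w = w $ 1 *\<^sub>R c1 (g y) + w $ 2 *\<^sub>R c2 (g y)" for w
    proof -
      have w: "w $ 1 *\<^sub>R axis 1 1 + w $ 2 *\<^sub>R axis 2 1 = w"
        by (simp add: vec_eq_iff forall_2 axis_def)
      have "frechet_derivative f (at (g y)) (w $ 1 *\<^sub>R axis 1 1 + w $ 2 *\<^sub>R axis 2 1) =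
          w $ 1 *\<^sub>R c1 (g y) + w $ 2 *\<^sub>R c2 (g y)"
        by (simp add: linear_add[OF lin] linear_scale[OF lin] c1_def c2_def)
      then show ?thesis by (simp only: w)
    qed
    have "((f \<circ> g) has_derivative (frechet_derivative f (at (g y)) \<circ> g' y)) (at y)"
      by (rule diff_chain_at[OF g'[OF y] smooth_on_has_derivative[OF f gy]])
    moreover have "((\<lambda>z. z) has_derivative (\<lambda>z. z)) (at y)" by simp
    then have "((f \<circ> g) has_derivative (\<lambda>z. z)) (at y)"
      by (rule has_derivative_transform_within_open[OF _ V y]) (use hom in \<open>simp add: homeomorphism_def\<close>)
    ultimately have "frechet_derivative f (at (g y)) \<circ> g' y = (\<lambda>z. z)"
      by (rule has_derivative_unique)
    then have "frechet_derivative f (at (g y)) (g' y w) = w" for w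
      by (metis comp_apply)
    then have eq: "g' y w $ 1 *\<^sub>R c1 (g y) + g' y w $ 2 *\<^sub>R c2 (g y) = w" for w
      using expand by metis
    have eq1: "g' y w $ 1 * c1 (g y) $ 1 + g' y w $ 2 * c2 (g y) $ 1 = w $ 1" for w
      using arg_cong[OF eq[of w], of "\<lambda>z. z $ 1"] by simp
    have eq2: "g' y w $ 1 * c1 (g y) $ 2 + g' y w $ 2 * c2 (g y) $ 2 = w $ 2" for w
      using arg_cong[OF eq[of w], of "\<lambda>z. z $ 2"] by simp
    \<comment> \<open>Multiplicativity of the 2x2 determinant, applied to the derivative of
      \<open>f\<close> composed with that of \<open>g\<close>. On the standard basis the right-hand
      side is 1, so \<open>D (g y)\<close> cannot vanish.\<close>
    have "(g' y w $ 1 * g' y z $ 2 - g' y w $ 2 * g' y z $ 1) * D (g y) = w $ 1 * z $ 2 - w $ 2 * z $ 1"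
      for w z
      unfolding D_def eq1[of w, symmetric] eq1[of z, symmetric]
        eq2[of w, symmetric] eq2[of z, symmetric] by (simp add: algebra_simps)
    from this[of "axis 1 1" "axis 2 1"] have D: "D (g y) \<noteq> 0"
      by (auto simp: axis_def)
    have "g' y v $ 1 * D (g y) = v $ 1 * c2 (g y) $ 2 - v $ 2 * c2 (g y) $ 1"
      unfolding D_def eq1[of v, symmetric] eq2[of v, symmetric] by (simp add: algebra_simps)
    moreover have "g' y v $ 2 * D (g y) = v $ 2 * c1 (g y) $ 1 - v $ 1 * c1 (g y) $ 2"
      unfolding D_def eq1[of v, symmetric] eq2[of v, symmetric] by (simp add: algebra_simps)
    ultimately have "g' y v = H v (g y)"
      using D by (simp add: H_def vec_eq_iff forall_2 eq_divide_eq)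
    then show ?thesis using D by simp
  qed
  have gU': "g ` V \<subseteq> U'"
    using inverse hom unfolding U'_def homeomorphism_def by blast
  have "higher_differentiable_on V g n" for n
  proof (induction n)
    case 0
    then show ?case using hom by (simp add: homeomorphism_def)
  next
    case (Suc n)
    show ?case
    proof (rule higher_differentiable_on_SucI[OF V g'])
      show "higher_differentiable_on V (\<lambda>y. g' y v) n" for v
      proof (rule higher_differentiable_on_cong[OF V])
        show "higher_differentiable_on V (\<lambda>y. H v (g y)) n"
          using H[of v] by (intro higher_differentiable_on_compose[OF V U' gU' _ Suc])
            (simp add: smooth_on_def)
      qed (use inverse in simp)
    qed
  qed
  then show ?thesis by (simp add: smooth_on_def)
qed

section \<open>Local coordinates from a nonzero Jacobian determinant\<close>

lemma det_jacobian_nz_iff_inj: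
  fixes f :: "real^2 \<Rightarrow> real^2"
  assumes "(f has_derivative f') (at p)"
  shows "det (jacobian f (at p)) \<noteq> 0 \<longleftrightarrow> inj f'"
  using assms frechet_derivative_at[OF assms] has_derivative_linear[OF assms]
  by (simp add: jacobian_def det_nz_iff_inj)

lemma det_jacobian:
  fixes f :: "real^2 \<Rightarrow> real^2"
  assumes "(f has_derivative (\<lambda>h. vector [a * h $ 1 + b * h $ 2, c * h $ 1 + d * h $ 2])) (at p)"
  shows "det (jacobian f (at p)) = a * d - b * c"
  using frechet_derivative_at[OF assms, symmetric]
  by (simp add: jacobian_def matrix_def det_2 axis_def)

text \<open>The inverse function theorem asks for a continuous derivative with values in the bounded
  linear maps, obtained here from its values on fixed vectors. It returns an inverse that is merely
  differentiable; \<open>smooth_on_inverse_function\<close> makes it smooth.\<close>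

lemma smooth_local_diffeomorphism:
  fixes f :: "real^2 \<Rightarrow> real^2"
  assumes S: "open S" "p \<in> S" and f: "smooth_on S f" and det: "det (jacobian f (at p)) \<noteq> 0"
  obtains U V where "p \<in> U" "U \<subseteq> S" "diffeomorphism U V f"
proof -
  define f' where "f' = (\<lambda>x. Blinfun (frechet_derivative f (at x)))"
  have der: "(f has_derivative frechet_derivative f (at x)) (at x)" if "x \<in> S" for x
    using f that by (rule smooth_on_has_derivative)
  have f': "blinfun_apply (f' x) = frechet_derivative f (at x)" if "x \<in> S" for x
    unfolding f'_def using has_derivative_bounded_linear[OF der[OF that]]
    by (rule bounded_linear_Blinfun_apply)
  have cont: "continuous_on S f'"
  proof (rule continuous_on_blinfun_componentwise)
    fix i :: "real^2"
    have "continuous_on S (\<lambda>x. frechet_derivative f (at x) i)"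
      using f unfolding smooth_on_def
      by (metis higher_differentiable_on.simps)
    then show "continuous_on S (\<lambda>x. blinfun_apply (f' x) i)"
      by (rule continuous_on_eq) (simp add: f')
  qed
  have lin: "linear (frechet_derivative f (at p))"
    using has_derivative_linear[OF der[OF S(2)]] .
  have "inj (frechet_derivative f (at p))"
    using det_jacobian_nz_iff_inj[OF der[OF S(2)]] det by simp
  then obtain L where L: "linear L" "L \<circ> frechet_derivative f (at p) = id"
    using linear_injective_left_inverse[OF lin] by blast
  have invf: "Blinfun L o\<^sub>L f' p = id_blinfun"
    using L(2) by (intro blinfun_eqI)
      (simp add: f' S bounded_linear_Blinfun_apply linear_conv_bounded_linear[THEN iffD1, OF L(1)]
        fun_eq_iff)
  obtain U V g g' where UV: "open U" "U \<subseteq> S" "p \<in> U" "open V" "f p \<in> V" "homeomorphism U V f g"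
    "\<And>y. y \<in> V \<Longrightarrow> (g has_derivative (g' y)) (at y)"
    using inverse_function_theorem[OF S(1) _ cont S(2) invf, of f] der f' by metis
  have "smooth_on V g"
    by (rule smooth_on_inverse_function[OF UV(1,4) smooth_on_subset[OF f UV(2)] UV(6,7)])
  then have "diffeomorphism U V f"
    unfolding diffeomorphism_def using UV smooth_on_subset[OF f UV(2)] by blast
  with UV that show thesis by blast
qed

section \<open>Equivalence of maps and invariants\<close>

lemma A_equivalent_sym:
  assumes "A_equivalent U V F U' V' G"
  shows "A_equivalent U' V' G U V F"
proof -
  obtain \<Phi> \<Psi> where F: "smooth_map U V F" and G: "smooth_map U' V' G"
    and \<Phi>: "diffeomorphism U' U \<Phi>" and \<Psi>: "diffeomorphism V V' \<Psi>"
    and eq: "\<And>x. x \<in> U' \<Longrightarrow> \<Psi> (F (\<Phi> x)) = G x"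
    using assms unfolding A_equivalent_def by blast
  have "inv_into V \<Psi> (G (inv_into U' \<Phi> x)) = F x" if "x \<in> U" for x
  proof -
    have "inv_into U' \<Phi> x \<in> U'" "\<Phi> (inv_into U' \<Phi> x) = x"
      using diffeomorphism_image[OF \<Phi>] that by (auto intro: inv_into_into f_inv_into_f)
    moreover have "F x \<in> V" using F that by (auto simp: smooth_map_def)
    ultimately show ?thesis
      using eq[of "inv_into U' \<Phi> x"] diffeomorphism_inj_on[OF \<Psi>] by (simp add: inv_into_f_eq)
  qed
  then show ?thesis
    using F G diffeomorphism_inverse[OF \<Phi>] diffeomorphism_inverse[OF \<Psi>]
    unfolding A_equivalent_def by blast
qed

lemma A_equivalent_trans:
  fixes F :: "'a::euclidean_space \<Rightarrow> 'b::euclidean_space"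
    and G :: "'c::euclidean_space \<Rightarrow> 'd::euclidean_space"
    and H :: "'e::euclidean_space \<Rightarrow> 'f::euclidean_space"
  assumes "A_equivalent U V F U' V' G" "A_equivalent U' V' G U'' V'' H"
  shows "A_equivalent U V F U'' V'' H"
proof -
  obtain \<Phi> \<Psi> where F: "smooth_map U V F"
    and 1: "diffeomorphism U' U \<Phi>" "diffeomorphism V V' \<Psi>"
    and eq1: "\<And>x. x \<in> U' \<Longrightarrow> \<Psi> (F (\<Phi> x)) = G x"
    using assms(1) unfolding A_equivalent_def by blast
  obtain \<Phi>' \<Psi>' where H: "smooth_map U'' V'' H"
    and 2: "diffeomorphism U'' U' \<Phi>'" "diffeomorphism V' V'' \<Psi>'"
    and eq2: "\<And>x. x \<in> U'' \<Longrightarrow> \<Psi>' (G (\<Phi>' x)) = H x"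
    using assms(2) unfolding A_equivalent_def by blast
  have "\<Psi>' (\<Psi> (F (\<Phi> (\<Phi>' x)))) = H x" if "x \<in> U''" for x
    using eq1[of "\<Phi>' x"] eq2[OF that] diffeomorphism_image[OF 2(1)] that by auto
  then show ?thesis
    using F H diffeomorphism_compose[OF 2(1) 1(1)] diffeomorphism_compose[OF 1(2) 2(2)]
    unfolding A_equivalent_def by blast
qed

text \<open>The invariant that separates the classes. It is local on purpose: two parabolas can meet
  in four points, so \<open>cusp_form\<close> attains some values four times, but at most three of
  these preimages can come together.\<close>

definition locally_multiple :: "nat \<Rightarrow> ('a::topological_space \<Rightarrow> 'b) \<Rightarrow> 'a \<Rightarrow> bool" where
  "locally_multiple k F x \<longleftrightarrow>
     (\<forall>U. open U \<and> x \<in> U \<longrightarrow> (\<exists>A y. A \<subseteq> U \<and> card A = k \<and> (\<forall>a\<in>A. F a = y)))"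

lemma locally_multiple_mono:
  assumes "locally_multiple k F x" "j \<le> k"
  shows "locally_multiple j F x"
  unfolding locally_multiple_def
proof (intro allI impI)
  fix U assume "open U \<and> x \<in> U"
  then obtain A y where A: "A \<subseteq> U" "card A = k" "\<forall>a\<in>A. F a = y"
    using assms(1) unfolding locally_multiple_def by blast
  obtain B where "B \<subseteq> A" "card B = j"
    using obtain_subset_with_card_n[of j A] A(2) assms(2) by auto
  then show "\<exists>A y. A \<subseteq> U \<and> card A = j \<and> (\<forall>a\<in>A. F a = y)"
    using A by blast
qed

text \<open>Points with a common image keep one under any map of the target, so it suffices to pull
  the finite set back along the source diffeomorphism.\<close>

lemma locally_multiple_transfer:
  assumes \<Phi>: "diffeomorphism U' U \<Phi>" and x: "x \<in> U'"
    and eq: "\<And>z. z \<in> U' \<Longrightarrow> \<Psi> (F (\<Phi> z)) = G z" and mult: "locally_multiple k F (\<Phi> x)"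
  shows "locally_multiple k G x"
  unfolding locally_multiple_def
proof (intro allI impI)
  fix W assume W: "open W \<and> x \<in> W"
  have "open (\<Phi> ` (W \<inter> U'))"
    using diffeomorphism_restrict[OF \<Phi>, of "W \<inter> U'"] W diffeomorphism_open(1)[OF \<Phi>]
    by (auto dest: diffeomorphism_open(2))
  moreover have "\<Phi> x \<in> \<Phi> ` (W \<inter> U')" using W x by blast
  ultimately obtain A y where A: "A \<subseteq> \<Phi> ` (W \<inter> U')" "card A = k" "\<forall>a\<in>A. F a = y"
    using mult unfolding locally_multiple_def by metis
  then obtain B where B: "B \<subseteq> W \<inter> U'" "A = \<Phi> ` B"
    using subset_image_iff[of A \<Phi> "W \<inter> U'"] by auto
  have "inj_on \<Phi> B"
    using diffeomorphism_inj_on[OF \<Phi>] B(1) by (auto intro: inj_on_subset)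
  then have "card B = k" using A(2) B(2) by (simp add: card_image)
  moreover have "\<forall>b\<in>B. G b = \<Psi> y"
    using A(3) B eq by fastforce
  ultimately show "\<exists>A y. A \<subseteq> W \<and> card A = k \<and> (\<forall>a\<in>A. G a = y)"
    using B(1) by blast
qed

lemma A_equivalent_locally_multiple:
  assumes "A_equivalent U V F U' V' G" "x \<in> U" "locally_multiple k F x"
  shows "\<exists>y\<in>U'. locally_multiple k G y"
proof -
  obtain \<Phi> \<Psi> where \<Phi>: "diffeomorphism U' U \<Phi>"
    and eq: "\<And>x. x \<in> U' \<Longrightarrow> \<Psi> (F (\<Phi> x)) = G x"
    using assms(1) unfolding A_equivalent_def by blast
  obtain z where "z \<in> U'" "x = \<Phi> z"
    using diffeomorphism_image[OF \<Phi>] assms(2) by blast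
  then show ?thesis
    using locally_multiple_transfer[OF \<Phi>, of z \<Psi> F G k] eq assms(3) by blast
qed

text \<open>A value fixes the first coordinate and the square of the second.\<close>

lemma not_locally_multiple_fold_model: "\<not> locally_multiple 3 fold_model x"
proof
  assume "locally_multiple 3 fold_model x"
  then obtain A y where A: "card A = 3" "\<forall>a\<in>A. fold_model a = y"
    unfolding locally_multiple_def using open_UNIV by blast
  have "A \<subseteq> {vector [y $ 1, sqrt (y $ 2)], vector [y $ 1, - sqrt (y $ 2)]}" (is "_ \<subseteq> ?B")
  proof
    fix a assume "a \<in> A"
    then have "y $ 1 = a $ 1" "y $ 2 = (a $ 2)\<^sup>2"
      using A(2) by (auto simp: fold_model_def)
    then show "a \<in> ?B"
      by (auto simp: vec_eq_iff forall_2 abs_if split: if_splits)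
  qed
  then have "card A \<le> card ?B" by (intro card_mono) auto
  also have "\<dots> \<le> 2" by (simp add: card_insert_if)
  finally show False using A(1) by simp
qed

lemma not_fold_point_if_locally_multiple:
  assumes "locally_multiple 3 F x"
  shows "\<not> fold_point F x"
proof
  assume "fold_point F x"
  then obtain U U' \<Phi> \<Psi> where "0 \<in> U'" "diffeomorphism U' U \<Phi>" "\<Phi> 0 = x"
    "\<And>z. z \<in> U' \<Longrightarrow> \<Psi> (F (\<Phi> z)) = fold_model z"
    unfolding fold_point_def germ_A_equivalent_def by blast
  then show False
    using locally_multiple_transfer[of U' U \<Phi> 0 \<Psi> F fold_model 3] assms
      not_locally_multiple_fold_model by simp
qed

section \<open>Germs compared through auxiliary coordinates\<close>

lemma diffeomorphism_inj_derivative: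
  assumes f: "diffeomorphism U V f" and x: "x \<in> U" and f': "(f has_derivative f') (at x)"
  shows "inj f'"
proof -
  let ?g = "inv_into U f"
  have y: "f x \<in> V" using diffeomorphism_image[OF f] x by blast
  obtain g' where "(?g has_derivative g') (at (f x))"
    using smooth_on_has_derivative[OF diffeomorphism_smooth[OF diffeomorphism_inverse[OF f]] y] by blast
  then have "((?g \<circ> f) has_derivative (g' \<circ> f')) (at x)"
    by (rule diff_chain_at[OF f'])
  moreover have "((?g \<circ> f) has_derivative (\<lambda>z. z)) (at x)"
  proof (rule has_derivative_transform_within_open[of "\<lambda>z. z"])
    show "open U" "x \<in> U" using f x by (auto dest: diffeomorphism_open)
    show "z = (?g \<circ> f) z" if "z \<in> U" for z
      using diffeomorphism_inj_on[OF f] that by simp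
  qed simp
  ultimately have "g' \<circ> f' = (\<lambda>z. z)" by (rule has_derivative_unique)
  then show ?thesis by (metis inj_on_id2 inj_on_imageI2)
qed

text \<open>Both sources are parametrized from one auxiliary plane, by \<open>\<kappa>\<close> and
  by \<open>\<rho>\<close>. The change of coordinates is \<open>\<kappa>\<close> after the local
  inverse of \<open>\<rho>\<close>, so neither map has to be inverted by hand; only Jacobians at the
  base point are computed.\<close>

lemma germ_A_equivalentI:
  fixes F G \<kappa> \<rho> \<Psi> :: "real^2 \<Rightarrow> real^2"
  assumes S: "open S" "p \<in> S" and \<kappa>: "smooth_on S \<kappa>" "det (jacobian \<kappa> (at p)) \<noteq> 0"
    and \<rho>: "smooth_on S \<rho>" "det (jacobian \<rho> (at p)) \<noteq> 0"
    and \<Psi>: "diffeomorphism V V' \<Psi>"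
    and eq: "\<And>q. q \<in> S \<Longrightarrow> F (\<kappa> q) \<in> V" "\<And>q. q \<in> S \<Longrightarrow> \<Psi> (F (\<kappa> q)) = G (\<rho> q)"
  shows "germ_A_equivalent F (\<kappa> p) G (\<rho> p)"
proof -
  obtain A B where A: "p \<in> A" "A \<subseteq> S" "diffeomorphism A B \<kappa>"
    using smooth_local_diffeomorphism[OF S \<kappa>] .
  obtain A' B' where A': "p \<in> A'" "A' \<subseteq> S" "diffeomorphism A' B' \<rho>"
    using smooth_local_diffeomorphism[OF S \<rho>] .
  define W where "W = A \<inter> A'"
  have "open W"
    using A(3) A'(3) by (auto simp: W_def dest: diffeomorphism_open)
  then have \<kappa>W: "diffeomorphism W (\<kappa> ` W) \<kappa>" and \<rho>W: "diffeomorphism W (\<rho> ` W) \<rho>"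
    using A(3) A'(3) by (auto simp: W_def intro: diffeomorphism_restrict)
  let ?\<Phi> = "\<lambda>x. \<kappa> (inv_into W \<rho> x)"
  have inv: "inv_into W \<rho> (\<rho> q) = q" if "q \<in> W" for q
    using diffeomorphism_inj_on[OF \<rho>W] that by simp
  have W: "p \<in> W" "W \<subseteq> S" using A(1,2) A'(1) by (auto simp: W_def)
  show ?thesis
    unfolding germ_A_equivalent_def
  proof (intro exI conjI)
    show "diffeomorphism (\<rho> ` W) (\<kappa> ` W) ?\<Phi>"
      by (rule diffeomorphism_compose[OF diffeomorphism_inverse[OF \<rho>W] \<kappa>W])
    show "diffeomorphism V V' \<Psi>" by fact
    show "\<kappa> p \<in> \<kappa> ` W" "\<rho> p \<in> \<rho> ` W" using W by auto
    show "F ` \<kappa> ` W \<subseteq> V" "\<Psi> (F (\<kappa> p)) = G (\<rho> p)" using W eq by auto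
    show "?\<Phi> (\<rho> p) = \<kappa> p" by (simp add: inv W)
    show "\<forall>x\<in>\<rho> ` W. \<Psi> (F (?\<Phi> x)) = G x" using W eq by (auto simp: inv)
  qed
qed

text \<open>For a target change given explicitly on the target of \<open>F\<close>, as in the cusp
  case. Continuity of \<open>F\<close> shrinks the source until its image lies where \<Psi> is
  invertible.\<close>

lemma germ_A_equivalent_target_pullback:
  fixes F G \<kappa> \<rho> \<Psi> :: "real^2 \<Rightarrow> real^2"
  assumes S: "open S" "p \<in> S" and \<kappa>: "smooth_on S \<kappa>" "det (jacobian \<kappa> (at p)) \<noteq> 0"
    and \<rho>: "smooth_on S \<rho>" "det (jacobian \<rho> (at p)) \<noteq> 0"
    and T: "open T" "F (\<kappa> p) \<in> T" and \<Psi>: "smooth_on T \<Psi>" "det (jacobian \<Psi> (at (F (\<kappa> p)))) \<noteq> 0"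
    and F: "continuous_on UNIV F"
    and eq: "\<And>q. q \<in> S \<Longrightarrow> \<Psi> (F (\<kappa> q)) = G (\<rho> q)"
  shows "germ_A_equivalent F (\<kappa> p) G (\<rho> p)"
proof -
  obtain V V' where V: "F (\<kappa> p) \<in> V" "V \<subseteq> T" "diffeomorphism V V' \<Psi>"
    using smooth_local_diffeomorphism[OF T \<Psi>] .
  let ?S = "S \<inter> (\<lambda>q. F (\<kappa> q)) -` V"
  have "continuous_on S (\<lambda>q. F (\<kappa> q))"
    by (rule continuous_on_compose2[OF F smooth_on_imp_continuous_on[OF \<kappa>(1)]]) simp
  then have "open ?S"
    using continuous_open_preimage S(1) diffeomorphism_open(1)[OF V(3)] by blast
  then show ?thesis
    using V eq S \<kappa>(2) \<rho>(2) smooth_on_subset[OF \<kappa>(1), of ?S] smooth_on_subset[OF \<rho>(1), of ?S]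
    by (intro germ_A_equivalentI[of ?S p \<kappa> \<rho> V V' \<Psi> F G]) auto
qed

text \<open>For a target change given explicitly on the target of the model, as in the fold case:
  there the value of \<open>F\<close> is known as a function of the value of the model.\<close>

lemma germ_A_equivalent_target_pushforward:
  fixes F G \<kappa> \<rho> \<Theta> :: "real^2 \<Rightarrow> real^2"
  assumes S: "open S" "p \<in> S" and \<kappa>: "smooth_on S \<kappa>" "det (jacobian \<kappa> (at p)) \<noteq> 0"
    and \<rho>: "smooth_on S \<rho>" "det (jacobian \<rho> (at p)) \<noteq> 0"
    and T: "open T" "G (\<rho> p) \<in> T" and \<Theta>: "smooth_on T \<Theta>" "det (jacobian \<Theta> (at (G (\<rho> p)))) \<noteq> 0"
    and G: "continuous_on UNIV G"
    and eq: "\<And>q. q \<in> S \<Longrightarrow> F (\<kappa> q) = \<Theta> (G (\<rho> q))"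
  shows "germ_A_equivalent F (\<kappa> p) G (\<rho> p)"
proof -
  obtain V V' where V: "G (\<rho> p) \<in> V" "V \<subseteq> T" "diffeomorphism V V' \<Theta>"
    using smooth_local_diffeomorphism[OF T \<Theta>] .
  let ?S = "S \<inter> (\<lambda>q. G (\<rho> q)) -` V"
  have "continuous_on S (\<lambda>q. G (\<rho> q))"
    by (rule continuous_on_compose2[OF G smooth_on_imp_continuous_on[OF \<rho>(1)]]) simp
  then have "open ?S"
    using continuous_open_preimage S(1) diffeomorphism_open(1)[OF V(3)] by blast
  moreover have "F (\<kappa> q) \<in> V'" "inv_into V \<Theta> (F (\<kappa> q)) = G (\<rho> q)" if "q \<in> ?S" for q
    using that eq[of q] diffeomorphism_inj_on[OF V(3)] diffeomorphism_image[OF V(3)] by auto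
  ultimately show ?thesis
    using V(1) S \<kappa>(2) \<rho>(2) smooth_on_subset[OF \<kappa>(1), of ?S] smooth_on_subset[OF \<rho>(1), of ?S]
      diffeomorphism_inverse[OF V(3)]
    by (intro germ_A_equivalentI[of ?S p \<kappa> \<rho> V' V "inv_into V \<Theta>" F G]) auto
qed

text \<open>Names the two diffeomorphisms that \<open>A_equivalent\<close> only asserts to exist, so
  that points, singular sets and germs can be carried from \<open>G\<close> to \<open>F\<close>
  along \<Phi>.\<close>

locale plane_A_equivalence =
  fixes V :: "(real^2) set" and F G \<Phi> \<Psi> :: "real^2 \<Rightarrow> real^2"
  assumes F: "smooth_map UNIV V F" and G: "smooth_on UNIV G"
    and \<Phi>: "diffeomorphism UNIV UNIV \<Phi>" and \<Psi>: "diffeomorphism V UNIV \<Psi>"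
    and eq: "\<Psi> (F (\<Phi> x)) = G x"
begin

lemma A_equivalent: "A_equivalent UNIV V F UNIV UNIV G"
  unfolding A_equivalent_def using F G \<Phi> \<Psi> eq by (auto simp: smooth_map_def)

lemma F_in: "F x \<in> V"
  using F by (auto simp: smooth_map_def)

lemma F_eq: "F (\<Phi> x) = inv_into V \<Psi> (G x)"
  using inv_into_f_f[OF diffeomorphism_inj_on[OF \<Psi>] F_in[of "\<Phi> x"]] by (simp add: eq)

text \<open>A nonzero Jacobian determinant means an injective derivative, and injectivity is
  unaffected by composition with the invertible derivatives of \<Phi> and \<Psi>.\<close>

lemma singular_iff: "\<Phi> x \<in> singular_set F \<longleftrightarrow> x \<in> singular_set G"
proof -
  let ?F' = "frechet_derivative F (at (\<Phi> x))"
  let ?\<Phi>' = "frechet_derivative \<Phi> (at x)"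
  let ?\<Psi>' = "frechet_derivative \<Psi> (at (F (\<Phi> x)))"
  have F': "(F has_derivative ?F') (at (\<Phi> x))"
    by (rule smooth_on_has_derivative[of UNIV]) (use F in \<open>auto simp: smooth_map_def\<close>)
  have \<Phi>': "(\<Phi> has_derivative ?\<Phi>') (at x)"
    by (rule smooth_on_has_derivative[OF diffeomorphism_smooth[OF \<Phi>]]) simp
  have \<Psi>': "(\<Psi> has_derivative ?\<Psi>') (at (F (\<Phi> x)))"
    by (rule smooth_on_has_derivative[OF diffeomorphism_smooth[OF \<Psi>]]) (rule F_in)
  have "((\<Psi> \<circ> (F \<circ> \<Phi>)) has_derivative (?\<Psi>' \<circ> (?F' \<circ> ?\<Phi>'))) (at x)"
    by (intro diff_chain_at) (simp_all add: F' \<Phi>' \<Psi>')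
  then have G': "(G has_derivative (?\<Psi>' \<circ> (?F' \<circ> ?\<Phi>'))) (at x)"
    by (simp add: comp_def eq)
  have inj: "inj ?\<Phi>'" "inj ?\<Psi>'"
    using diffeomorphism_inj_derivative[OF \<Phi> _ \<Phi>'] diffeomorphism_inj_derivative[OF \<Psi> F_in \<Psi>'] by auto
  have "surj ?\<Phi>'"
    using linear_inj_imp_surj[OF has_derivative_linear[OF \<Phi>'] inj(1)] .
  have "inj (?\<Psi>' \<circ> (?F' \<circ> ?\<Phi>')) \<longleftrightarrow> inj ?F'"
  proof
    assume "inj (?\<Psi>' \<circ> (?F' \<circ> ?\<Phi>'))"
    then have "inj (?F' \<circ> ?\<Phi>')" by (rule inj_on_imageI2)
    then show "inj ?F'"
      using \<open>surj ?\<Phi>'\<close> inj_on_imageI[of ?F' ?\<Phi>' UNIV] by simp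
  next
    assume "inj ?F'"
    then show "inj (?\<Psi>' \<circ> (?F' \<circ> ?\<Phi>'))"
      using inj by (intro inj_compose)
  qed
  then show ?thesis
    using det_jacobian_nz_iff_inj[OF F'] det_jacobian_nz_iff_inj[OF G']
    by (auto simp: singular_set_def)
qed

lemma singular_set_eq: "singular_set F = \<Phi> ` singular_set G"
  using singular_iff diffeomorphism_image[OF \<Phi>] by (metis (mono_tags) UNIV_I image_iff set_eqI)

text \<open>The coordinates for the germ of \<open>G\<close> are composed with \<Phi> and with
  \<Psi> restricted to the preimage of \<open>V1\<close>. The restriction appears as the inverse of
  a restricted inverse, the form that \<open>diffeomorphism_restrict\<close> delivers.\<close>

lemma germ:
  fixes M :: "real^2 \<Rightarrow> real^2"
  assumes "germ_A_equivalent G x M y"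
  shows "germ_A_equivalent F (\<Phi> x) M y"
proof -
  obtain U1 V1 U1' V1' \<Phi>1 \<Psi>1 where G1: "x \<in> U1" "y \<in> U1'" "G ` U1 \<subseteq> V1"
    and \<Phi>1: "diffeomorphism U1' U1 \<Phi>1" and \<Psi>1: "diffeomorphism V1 V1' \<Psi>1"
    and eq1: "\<Phi>1 y = x" "\<Psi>1 (G x) = M y" "\<And>z. z \<in> U1' \<Longrightarrow> \<Psi>1 (G (\<Phi>1 z)) = M z"
    using assms unfolding germ_A_equivalent_def by blast
  let ?V = "inv_into V \<Psi> ` V1"
  have "diffeomorphism V1 ?V (inv_into V \<Psi>)"
    using diffeomorphism_restrict[OF diffeomorphism_inverse[OF \<Psi>]] diffeomorphism_open[OF \<Psi>1] by auto
  then have \<Psi>V: "diffeomorphism ?V V1 (inv_into V1 (inv_into V \<Psi>))"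
    by (rule diffeomorphism_inverse)
  have "inv_into V1 (inv_into V \<Psi>) (inv_into V \<Psi> z) = z" if "z \<in> V1" for z
    using that diffeomorphism_inj_on[OF diffeomorphism_inverse[OF \<Psi>]]
    by (intro inv_into_f_f) (auto intro: inj_on_subset)
  then have \<Psi>_F: "inv_into V1 (inv_into V \<Psi>) (F (\<Phi> z)) = G z" if "z \<in> U1" for z
    using that G1(3) by (auto simp: F_eq)
  have \<Phi>U: "diffeomorphism U1 (\<Phi> ` U1) \<Phi>"
    using diffeomorphism_restrict[OF \<Phi>] diffeomorphism_open[OF \<Phi>1] by auto
  show ?thesis
    unfolding germ_A_equivalent_def
  proof (intro exI conjI)
    show "\<Phi> x \<in> \<Phi> ` U1" "y \<in> U1'" using G1 by auto
    show "F ` \<Phi> ` U1 \<subseteq> ?V" using G1(3) by (auto simp: F_eq)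
    show "diffeomorphism U1' (\<Phi> ` U1) (\<lambda>z. \<Phi> (\<Phi>1 z))"
      by (rule diffeomorphism_compose[OF \<Phi>1 \<Phi>U])
    show "diffeomorphism ?V V1' (\<lambda>z. \<Psi>1 (inv_into V1 (inv_into V \<Psi>) z))"
      by (rule diffeomorphism_compose[OF \<Psi>V \<Psi>1])
    show "\<Phi> (\<Phi>1 y) = \<Phi> x" by (simp add: eq1)
    show "\<Psi>1 (inv_into V1 (inv_into V \<Psi>) (F (\<Phi> x))) = M y" by (simp add: \<Psi>_F G1 eq1)
    have "\<Phi>1 z \<in> U1" if "z \<in> U1'" for z using diffeomorphism_image[OF \<Phi>1] that by blast
    then show "\<forall>z\<in>U1'. \<Psi>1 (inv_into V1 (inv_into V \<Psi>) (F (\<Phi> (\<Phi>1 z)))) = M z"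
      by (simp add: \<Psi>_F eq1)
  qed
qed

lemma locally_multiple: "locally_multiple k G x \<Longrightarrow> locally_multiple k F (\<Phi> x)"
proof (rule locally_multiple_transfer[OF diffeomorphism_inverse[OF \<Phi>], of _ "inv_into V \<Psi>" G])
  have surj: "surj \<Phi>" and inj: "inj \<Phi>"
    using diffeomorphism_image[OF \<Phi>] diffeomorphism_inj_on[OF \<Phi>] by auto
  show "inv_into V \<Psi> (G (inv \<Phi> z)) = F z" for z
    by (simp add: F_eq[symmetric] surj surj_f_inv_f)
  show "locally_multiple k G x \<Longrightarrow> locally_multiple k G (inv \<Phi> (\<Phi> x))"
    using inj by simp
qed simp

text \<open>Folds are carried over by \<open>germ\<close>, whereas three accumulating preimages
  persist at the image of \<open>p\<close> and rule out a fold there.\<close>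

lemma nonfold_singular_set_eq:
  assumes nf: "locally_multiple 3 G p" and p: "p \<in> singular_set G"
    and fold: "\<And>x. x \<in> singular_set G \<Longrightarrow> x \<noteq> p \<Longrightarrow> fold_point G x"
  shows "{x \<in> singular_set F. \<not> fold_point F x} = {\<Phi> p}"
proof -
  have "\<not> fold_point F (\<Phi> p)"
    using locally_multiple[OF nf] by (rule not_fold_point_if_locally_multiple)
  moreover have "fold_point F (\<Phi> x)" if "x \<in> singular_set G" "x \<noteq> p" for x
    using germ fold[OF that] unfolding fold_point_def by blast
  ultimately show ?thesis
    using p by (auto simp: singular_set_eq)
qed

end

section \<open>The quadratic normal forms\<close>

definition cusp_form :: "real^2 \<Rightarrow> real^2" where
  "cusp_form z = vector [(z $ 1)\<^sup>2 + z $ 2, (z $ 2)\<^sup>2 + z $ 1]"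

text \<open>Within reach of a pair of quadratic functions by affine changes, unlike the quartic
  \<open>node_model\<close>.\<close>

definition node_form :: "real^2 \<Rightarrow> real^2" where
  "node_form z = vector [(z $ 1)\<^sup>2, (z $ 2)\<^sup>2 + z $ 1]"

lemma smooth_cusp_form: "smooth_on UNIV cusp_form"
  unfolding cusp_form_def by (intro smooth_intros open_UNIV)

lemma smooth_node_form: "smooth_on UNIV node_form"
  unfolding node_form_def by (intro smooth_intros open_UNIV)

lemma smooth_fold_model: "smooth_on UNIV fold_model"
  unfolding fold_model_def by (intro smooth_intros open_UNIV)

lemma smooth_node_model: "smooth_on UNIV node_model"
  unfolding node_model_def by (intro smooth_intros open_UNIV)

section \<open>Jacobians and singular sets of the normal forms\<close>

lemma has_derivative_vec_nth [derivative_intros]: "((\<lambda>z. z $ i) has_derivative (\<lambda>h. h $ i)) F"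
  by (rule bounded_linear_imp_has_derivative) (rule bounded_linear_vec_nth)

lemma has_derivative_vector_2:
  assumes "(f has_derivative f') F" "(g has_derivative g') F"
  shows "((\<lambda>z. vector [f z, g z] :: real^2) has_derivative (\<lambda>h. vector [f' h, g' h])) F"
  unfolding vector_2_conv by (intro has_derivative_add has_derivative_scaleR_left assms)

lemma det_jacobian_vector_2:
  fixes f g :: "real^2 \<Rightarrow> real"
  assumes "(f has_derivative (\<lambda>h. a * h $ 1 + b * h $ 2)) (at p)"
    "(g has_derivative (\<lambda>h. c * h $ 1 + d * h $ 2)) (at p)"
  shows "det (jacobian (\<lambda>z. vector [f z, g z]) (at p)) = a * d - b * c"
  using det_jacobian[OF has_derivative_vector_2[OF assms]] .

lemma singular_set_cusp_form: "singular_set cusp_form = {z. 4 * z $ 1 * z $ 2 = 1}"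
proof -
  have "det (jacobian cusp_form (at p)) = (2 * p $ 1) * (2 * p $ 2) - 1 * 1" for p
    unfolding cusp_form_def
    by (rule det_jacobian_vector_2;
        (rule derivative_eq_intros refl | simp add: fun_eq_iff)+)
  then show ?thesis by (auto simp: singular_set_def)
qed

lemma singular_set_node_form: "singular_set node_form = {z. z $ 1 = 0} \<union> {z. z $ 2 = 0}"
proof -
  have "det (jacobian node_form (at p)) = (2 * p $ 1) * (2 * p $ 2) - 0 * 1" for p
    unfolding node_form_def
    by (rule det_jacobian_vector_2;
        (rule derivative_eq_intros refl | simp add: fun_eq_iff)+)
  then show ?thesis by (auto simp: singular_set_def)
qed

lemma singular_set_fold_model: "singular_set fold_model = {z. z $ 2 = 0}"
proof -
  have "det (jacobian fold_model (at p)) = 1 * (2 * p $ 2) - 0 * 0" for p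
    unfolding fold_model_def
    by (rule det_jacobian_vector_2;
        (rule derivative_eq_intros refl | simp add: fun_eq_iff)+)
  then show ?thesis by (auto simp: singular_set_def)
qed

text \<open>The coordinates \<open>\<kappa> (t, h)\<close> are adapted to the fold: \<open>t\<close> parametrizes the singular curve and \<open>h\<close>
  runs along the kernel direction; a quadratic map is then exactly quadratic in \<open>h\<close>.\<close>

lemma fold_pointI:
  fixes F \<kappa> \<Theta> :: "real^2 \<Rightarrow> real^2"
  assumes S: "open S" "vector [t, 0] \<in> S"
    and \<kappa>: "smooth_on S \<kappa>" "det (jacobian \<kappa> (at (vector [t, 0]))) \<noteq> 0"
    and T: "open T" "0 \<in> T" and \<Theta>: "smooth_on T \<Theta>" "det (jacobian \<Theta> (at 0)) \<noteq> 0"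
    and eq: "\<And>q. q \<in> S \<Longrightarrow> F (\<kappa> q) = \<Theta> (vector [q $ 1 - t, (q $ 2)\<^sup>2])"
  shows "fold_point F (\<kappa> (vector [t, 0]))"
proof -
  let ?\<rho> = "\<lambda>q::real^2. vector [q $ 1 - t, q $ 2] :: real^2"
  have z: "?\<rho> (vector [t, 0]) = 0" "fold_model 0 = 0"
    by (simp_all add: fold_model_def vec_eq_iff forall_2)
  have "smooth_on S ?\<rho>" by (intro smooth_intros S)
  moreover have "det (jacobian ?\<rho> (at p)) = 1 * 1 - 0 * 0" for p
    by (rule det_jacobian_vector_2;
        (rule derivative_eq_intros refl | simp add: fun_eq_iff)+)
  moreover have "fold_model (?\<rho> q) = vector [q $ 1 - t, (q $ 2)\<^sup>2]" for q
    by (simp add: fold_model_def)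
  ultimately have "germ_A_equivalent F (\<kappa> (vector [t, 0])) fold_model (?\<rho> (vector [t, 0]))"
    using T \<Theta> eq z
    by (intro germ_A_equivalent_target_pushforward[OF S \<kappa>, where T = T and \<Theta> = \<Theta>])
      (auto intro!: smooth_on_imp_continuous_on[OF smooth_fold_model])
  then show ?thesis by (simp only: fold_point_def z)
qed

section \<open>Fold points and the cusp of the normal forms\<close>

lemma fold_point_fold_model:
  assumes "x \<in> singular_set fold_model"
  shows "fold_point fold_model x"
proof -
  have x: "x = vector [x $ 1, 0]"
    using assms by (simp add: singular_set_fold_model vec_eq_iff forall_2)
  have "fold_point fold_model ((\<lambda>q::real^2. vector [q $ 1, q $ 2]) (vector [x $ 1, 0] :: real^2))"
  proof (rule fold_pointI[where S = UNIV and T = UNIV])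
    let ?\<Theta> = "\<lambda>w::real^2. vector [w $ 1 + x $ 1, w $ 2] :: real^2"
    show "smooth_on UNIV (\<lambda>q::real^2. vector [q $ 1, q $ 2] :: real^2)" "smooth_on UNIV ?\<Theta>"
      by (intro smooth_intros open_UNIV)+
    have "det (jacobian (\<lambda>q::real^2. vector [q $ 1, q $ 2] :: real^2) (at p)) = 1 * 1 - 0 * 0" for p
      by (rule det_jacobian_vector_2;
          (rule derivative_eq_intros refl | simp add: fun_eq_iff)+)
    then show "det (jacobian (\<lambda>q::real^2. vector [q $ 1, q $ 2] :: real^2) (at (vector [x $ 1, 0]))) \<noteq> 0"
      by simp
    have "det (jacobian ?\<Theta> (at p)) = 1 * 1 - 0 * 0" for p
      by (rule det_jacobian_vector_2;
          (rule derivative_eq_intros refl | simp add: fun_eq_iff)+)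
    then show "det (jacobian ?\<Theta> (at 0)) \<noteq> 0" by simp
  qed (auto simp: fold_model_def)
  then show ?thesis by (subst x) simp
qed

lemma fold_point_node_form:
  assumes "x \<in> singular_set node_form" "x \<noteq> 0"
  shows "fold_point node_form x"
proof (cases "x $ 1 = 0")
  case True
  define t where "t = x $ 2"
  have t: "t \<noteq> 0" using assms(2) True by (auto simp: t_def vec_eq_iff forall_2)
  \<comment> \<open>At (0, s) the kernel is spanned by (1, -1/(2s)). Moving by h along it gives the
    value (h^2, s^2 + h^2/(4s^2)), which depends on s and h^2 only; \<open>?\<Theta>\<close> is this
    expression with s measured from t.\<close>
  let ?\<kappa> = "\<lambda>q::real^2. vector [q $ 2, q $ 1 - q $ 2 / (2 * q $ 1)] :: real^2"
  let ?\<Theta> = "\<lambda>w::real^2. vector [w $ 2, (w $ 1 + t)\<^sup>2 + w $ 2 / (4 * (w $ 1 + t)\<^sup>2)] :: real^2"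
  let ?S = "{q::real^2. q $ 1 \<noteq> 0}" and ?T = "{w::real^2. w $ 1 + t \<noteq> 0}"
  have "fold_point node_form (?\<kappa> (vector [t, 0]))"
  proof (rule fold_pointI[where S = ?S and T = ?T])
    show S: "open ?S" "open ?T" by (intro open_Collect_neq continuous_intros)+
    show "smooth_on ?S ?\<kappa>" by (intro smooth_intros S) auto
    show "smooth_on ?T ?\<Theta>" by (intro smooth_intros S) auto
    have "det (jacobian ?\<kappa> (at (vector [t, 0]))) = 0 * (- 1 / (2 * t)) - 1 * 1"
      by (rule det_jacobian_vector_2;
          (rule derivative_eq_intros refl | simp add: fun_eq_iff t)+)
    then show "det (jacobian ?\<kappa> (at (vector [t, 0]))) \<noteq> 0" by simp
    have "det (jacobian ?\<Theta> (at 0)) = 0 * (1 / (4 * t\<^sup>2)) - 1 * (2 * t)"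
      by (rule det_jacobian_vector_2;
          (rule derivative_eq_intros refl | simp add: fun_eq_iff t)+)
    then show "det (jacobian ?\<Theta> (at 0)) \<noteq> 0" using t by simp
  qed (use t in \<open>auto simp: node_form_def vec_eq_iff forall_2 power2_eq_square field_simps\<close>)
  moreover have "?\<kappa> (vector [t, 0]) = x" using True by (simp add: t_def vec_eq_iff forall_2)
  ultimately show ?thesis by simp
next
  case False
  define t where "t = x $ 1"
  have t: "t \<noteq> 0" and x: "x = vector [t, 0]"
    using assms(1) False by (auto simp: t_def singular_set_node_form vec_eq_iff forall_2)
  \<comment> \<open>On the other axis the kernel is vertical, so the standard coordinates are
    already adapted.\<close>
  let ?\<Theta> = "\<lambda>w::real^2. vector [(w $ 1 + t)\<^sup>2, w $ 2 + w $ 1 + t] :: real^2"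
  have "fold_point node_form ((\<lambda>q::real^2. vector [q $ 1, q $ 2]) (vector [t, 0] :: real^2))"
  proof (rule fold_pointI[where S = UNIV and T = UNIV])
    show "smooth_on UNIV (\<lambda>q::real^2. vector [q $ 1, q $ 2] :: real^2)" "smooth_on UNIV ?\<Theta>"
      by (intro smooth_intros open_UNIV)+
    have "det (jacobian (\<lambda>q::real^2. vector [q $ 1, q $ 2] :: real^2) (at p)) = 1 * 1 - 0 * 0" for p
      by (rule det_jacobian_vector_2;
          (rule derivative_eq_intros refl | simp add: fun_eq_iff)+)
    then show "det (jacobian (\<lambda>q::real^2. vector [q $ 1, q $ 2] :: real^2) (at (vector [t, 0]))) \<noteq> 0"
      by simp
    have "det (jacobian ?\<Theta> (at 0)) = (2 * t) * 1 - 0 * 1"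
      by (rule det_jacobian_vector_2;
          (rule derivative_eq_intros refl | simp add: fun_eq_iff)+)
    then show "det (jacobian ?\<Theta> (at 0)) \<noteq> 0" using t by simp
  qed (auto simp: node_form_def)
  then show ?thesis using x by simp
qed

text \<open>At (s, 1/(4s)) the kernel is spanned by (1, -2s) and the hyperbola has direction (1,
  -1/(4s^2)). The two agree only if 8s^3 = 1, that is at the excluded point; elsewhere they are
  transversal and give local coordinates.\<close>

lemma fold_point_cusp_form:
  assumes "x \<in> singular_set cusp_form" "x \<noteq> vector [1/2, 1/2]"
  shows "fold_point cusp_form x"
proof -
  define t where "t = x $ 1"
  have tx: "4 * t * x $ 2 = 1" using assms(1) by (simp add: t_def singular_set_cusp_form)
  then have t: "t \<noteq> 0" by auto
  then have x2: "x $ 2 = 1 / (4 * t)" using tx by (simp add: eq_divide_eq mult_ac)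
  have "t \<noteq> 1/2"
  proof
    assume "t = 1/2"
    then have "x = vector [1/2, 1/2]" using x2 by (simp add: t_def vec_eq_iff forall_2)
    with assms(2) show False ..
  qed
  \<comment> \<open>The second factor is 4t^2 + 2t + 1 with its square completed, so t = 1/2 is the
    only real root.\<close>
  moreover have "8 * t ^ 3 - 1 = (2 * t - 1) * ((2 * t + 1/2)\<^sup>2 + 3/4)"
    by (simp add: power2_eq_square power3_eq_cube field_simps)
  moreover have "(2 * t + 1/2)\<^sup>2 + 3/4 > 0" by (simp add: add_nonneg_pos)
  ultimately have t3: "8 * t ^ 3 \<noteq> 1" by auto
  \<comment> \<open>The linear terms in h cancel: the value at (s + h, 1/(4s) - 2sh) is (s^2 +
    1/(4s) + h^2, s + 1/(16s^2) + 4s^2 h^2). Replacing s by its offset from t and h^2 by a free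
    variable gives \<open>?\<Theta>\<close>.\<close>
  let ?\<kappa> = "\<lambda>q::real^2. vector [q $ 1 + q $ 2, 1 / (4 * q $ 1) - 2 * q $ 1 * q $ 2] :: real^2"
  let ?\<Theta> = "\<lambda>w::real^2. vector [(w $ 1 + t)\<^sup>2 + 1 / (4 * (w $ 1 + t)) + w $ 2,
    w $ 1 + t + 1 / (16 * (w $ 1 + t)\<^sup>2) + 4 * (w $ 1 + t)\<^sup>2 * w $ 2] :: real^2"
  let ?S = "{q::real^2. q $ 1 \<noteq> 0}" and ?T = "{w::real^2. w $ 1 + t \<noteq> 0}"
  have "fold_point cusp_form (?\<kappa> (vector [t, 0]))"
  proof (rule fold_pointI[where S = ?S and T = ?T])
    show S: "open ?S" "open ?T" by (intro open_Collect_neq continuous_intros)+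
    show "smooth_on ?S ?\<kappa>" by (intro smooth_intros S) auto
    show "smooth_on ?T ?\<Theta>" by (intro smooth_intros S) auto
    have "det (jacobian ?\<kappa> (at (vector [t, 0]))) = 1 * (- 2 * t) - 1 * (- 1 / (4 * t\<^sup>2))"
      by (rule det_jacobian_vector_2;
          (rule derivative_eq_intros refl | simp add: fun_eq_iff t power2_eq_square)+)
    also have "\<dots> = (1 - 8 * t ^ 3) / (4 * t\<^sup>2)"
      using t by (simp add: field_simps power2_eq_square power3_eq_cube)
    finally show "det (jacobian ?\<kappa> (at (vector [t, 0]))) \<noteq> 0" using t t3 by simp
    have "det (jacobian ?\<Theta> (at 0)) =
      (2 * t - 1 / (4 * t\<^sup>2)) * (4 * t\<^sup>2) - 1 * (1 - 1 / (8 * t ^ 3))"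
      by (rule det_jacobian_vector_2;
          (rule derivative_eq_intros refl | simp add: fun_eq_iff t power2_eq_square power3_eq_cube
            field_simps)+)
    also have "\<dots> = (8 * t ^ 3 - 1)\<^sup>2 / (8 * t ^ 3)"
      using t by (simp add: field_simps power2_eq_square power3_eq_cube)
    finally show "det (jacobian ?\<Theta> (at 0)) \<noteq> 0" using t t3 by simp
  qed (use t in \<open>auto simp: cusp_form_def vec_eq_iff forall_2 power2_eq_square field_simps\<close>)
  moreover have "?\<kappa> (vector [t, 0]) = x" using x2 by (simp add: t_def vec_eq_iff forall_2)
  ultimately show ?thesis by simp
qed

text \<open>For a point \<open>(x, y)\<close> with image \<open>(u, v)\<close>, \<open>x\<close> is a root of the quartic
  \<open>x\<^sup>4 - 2ux\<^sup>2 + x + u\<^sup>2 - v\<close>, whose resolvent cubic is \<open>z\<^sup>3 - 4uz\<^sup>2 + 4vz - 1\<close>. The cusp model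
  describes a depressed cubic together with one of its roots \<open>Y\<close>. With \<open>w\<^sup>2\<close> a root of the resolvent,
  \<open>(x, w)\<close> are coordinates that give both a root of the quartic and one of the cubic.\<close>

lemma cusp_point_cusp_form: "cusp_point cusp_form (vector [1/2, 1/2])"
proof -
  \<comment> \<open>Write the quartic as (X^2 + wX + a)(X^2 - wX + b). Comparing coefficients gives
    a = (w^2 - 2u - 1/w)/2, and demanding that x be a root of the first factor determines y = u -
    x^2 by this formula.\<close>
  define y :: "real^2 \<Rightarrow> real" where
    "y = (\<lambda>q. q $ 1 * q $ 2 + (q $ 2)\<^sup>2 / 2 - 1 / (2 * q $ 2))"
  define u where "u = (\<lambda>q. (q $ 1)\<^sup>2 + y q)"
  define v where "v = (\<lambda>q. (y q)\<^sup>2 + q $ 1)"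
  define \<kappa> :: "real^2 \<Rightarrow> real^2" where "\<kappa> = (\<lambda>q. vector [q $ 1, y q])"
  \<comment> \<open>The shift z = Y + 4u/3 removes the quadratic term of the resolvent. What remains
    is Y^3 + pY = q with p and q the two components of \<open>\<Psi>\<close>, and
    \<open>\<rho>\<close> records p together with the root Y = w^2 - 4u/3.\<close>
  define \<rho> :: "real^2 \<Rightarrow> real^2" where
    "\<rho> = (\<lambda>q. vector [4 * v q - 16 * (u q)\<^sup>2 / 3, (q $ 2)\<^sup>2 - 4 * u q / 3])"
  define \<Psi> :: "real^2 \<Rightarrow> real^2" where
    "\<Psi> = (\<lambda>p. vector [4 * p $ 2 - 16 * (p $ 1)\<^sup>2 / 3,
      128 * (p $ 1) ^ 3 / 27 - 16 * p $ 1 * p $ 2 / 3 + 1])"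
  let ?S = "{q::real^2. q $ 2 \<noteq> 0}"
  \<comment> \<open>At the cusp u = v = 3/4 and the resolvent is (z - 1)^3, hence w = 1 or w = -1.
    With w = -1 the derivative of y in w would vanish and \<open>\<kappa>\<close> would not be a
    local coordinate.\<close>
  let ?p = "vector [1/2, 1] :: real^2"
  have S: "open ?S" by (intro open_Collect_neq continuous_intros)
  have y: "smooth_on ?S y" unfolding y_def by (intro smooth_intros S) auto
  have uv: "smooth_on ?S u" "smooth_on ?S v" unfolding u_def v_def by (intro smooth_intros S y)+
  have yp: "y ?p = 1/2" "u ?p = 3/4" by (simp_all add: y_def u_def power2_eq_square)
  have y': "(y has_derivative (\<lambda>h. h $ 1 + 2 * h $ 2)) (at ?p)"
    unfolding y_def
    by (rule derivative_eq_intros refl | simp add: fun_eq_iff)+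
  have u': "(u has_derivative (\<lambda>h. 2 * h $ 1 + 2 * h $ 2)) (at ?p)"
    unfolding u_def
    by (rule derivative_eq_intros y' refl | simp add: fun_eq_iff)+
  have v': "(v has_derivative (\<lambda>h. 2 * h $ 1 + 2 * h $ 2)) (at ?p)"
    unfolding v_def
    by (rule derivative_eq_intros y' refl | simp add: yp fun_eq_iff)+
  have "germ_A_equivalent cusp_form (\<kappa> ?p) cusp_model (\<rho> ?p)"
  proof (rule germ_A_equivalent_target_pullback[where S = ?S and T = UNIV
        and \<kappa> = \<kappa> and p = ?p and \<rho> = \<rho> and \<Psi> = \<Psi>])
    show "smooth_on ?S \<kappa>" unfolding \<kappa>_def by (intro smooth_intros S y)
    show "smooth_on ?S \<rho>" unfolding \<rho>_def by (intro smooth_intros S uv) simp_all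
    show "smooth_on UNIV \<Psi>" unfolding \<Psi>_def by (intro smooth_intros open_UNIV) simp_all
    have "det (jacobian \<kappa> (at ?p)) = 1 * 2 - 0 * 1"
      unfolding \<kappa>_def
      by (rule det_jacobian_vector_2;
          (rule derivative_eq_intros y' refl | simp add: fun_eq_iff)+)
    then show "det (jacobian \<kappa> (at ?p)) \<noteq> 0" by simp
    have "det (jacobian \<rho> (at ?p)) = (- 8) * (- 2/3) - (- 8) * (- 8/3)"
      unfolding \<rho>_def
      by (rule det_jacobian_vector_2;
          (rule derivative_eq_intros u' v' refl | simp add: fun_eq_iff yp field_simps)+)
    then show "det (jacobian \<rho> (at ?p)) \<noteq> 0" by simp
    have "cusp_form (\<kappa> ?p) = vector [3/4, 3/4]"
      by (simp add: cusp_form_def \<kappa>_def yp power2_eq_square)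
    moreover have "det (jacobian \<Psi> (at (vector [3/4, 3/4]))) = (- 8) * (- 4) - 4 * 4"
      unfolding \<Psi>_def
      by (rule det_jacobian_vector_2;
          (rule derivative_eq_intros refl | simp add: fun_eq_iff power2_eq_square field_simps)+)
    ultimately show "det (jacobian \<Psi> (at (cusp_form (\<kappa> ?p)))) \<noteq> 0" by simp
    show "continuous_on UNIV cusp_form"
      by (rule smooth_on_imp_continuous_on[OF smooth_cusp_form])
    fix q assume "q \<in> ?S"
    define x w where "x = q $ 1" and "w = q $ 2"
    have w: "w \<noteq> 0" using \<open>q \<in> ?S\<close> by (simp add: w_def)
    have yw: "2 * y q * w = 2 * x * w\<^sup>2 + w ^ 3 - 1"
      using w by (simp add: y_def x_def[symmetric] w_def[symmetric] field_simps
          power2_eq_square power3_eq_cube)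
    have "4 * v q * w\<^sup>2 = (2 * y q * w)\<^sup>2 + 4 * x * w\<^sup>2"
      by (simp add: v_def x_def power2_eq_square algebra_simps)
    moreover have "4 * u q * w ^ 4 = 4 * x\<^sup>2 * w ^ 4 + 2 * w ^ 3 * (2 * y q * w)"
      by (simp add: u_def x_def power2_eq_square power3_eq_cube power4_eq_xxxx algebra_simps)
    \<comment> \<open>The resolvent cubic at z = w^2, by elimination of y. Depressing it gives the
      cusp model.\<close>
    ultimately have "w ^ 6 - 4 * u q * w ^ 4 + 4 * v q * w\<^sup>2 - 1 = 0"
      unfolding yw by algebra
    then have "128 * (u q) ^ 3 / 27 - 16 * u q * v q / 3 + 1 =
        (4 * v q - 16 * (u q)\<^sup>2 / 3) * (w\<^sup>2 - 4 * u q / 3) + (w\<^sup>2 - 4 * u q / 3) ^ 3"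
      by algebra
    then show "\<Psi> (cusp_form (\<kappa> q)) = cusp_model (\<rho> q)"
      by (simp add: \<Psi>_def cusp_form_def \<kappa>_def cusp_model_def \<rho>_def u_def v_def w_def)
  qed (simp_all add: S)
  moreover have "\<kappa> ?p = vector [1/2, 1/2]" "\<rho> ?p = 0"
    by (simp_all add: \<kappa>_def \<rho>_def yp v_def vec_eq_iff forall_2 power2_eq_square)
  ultimately show ?thesis by (simp add: cusp_point_def)
qed

section \<open>How many preimages accumulate at a point\<close>

lemma norm_less_real2:
  fixes z :: "real^2"
  assumes "\<bar>z $ 1\<bar> + \<bar>z $ 2\<bar> < e"
  shows "norm z < e"
  using norm_le_l1_cart[of z] assms by (simp add: sum_2)

lemma locally_multiple_node_form: "locally_multiple 4 node_form 0"
  unfolding locally_multiple_def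
proof (intro allI impI)
  fix U :: "(real^2) set" assume "open U \<and> 0 \<in> U"
  then obtain e where e: "e > 0" "ball 0 e \<subseteq> U" using open_contains_ball by blast
  define s where "s = min 1 (e / 4)"
  have s: "s > 0" "s \<le> 1" "4 * s \<le> e" using e(1) by (auto simp: s_def)
  have s2: "s\<^sup>2 \<le> s" using s by (simp add: power2_eq_square mult_left_le)
  \<comment> \<open>A value (c^2, v) leaves x = c or x = -c, with y^2 = v - c or y^2 = v + c.
    Requiring these squares to be s^2 and 4s^2 forces c = 3s^2/2 and v = 5s^2/2. The bound s \<le> 1
    makes s^2 \<le> s, so all four points are within 4s of the origin.\<close>
  let ?x = "3 * s\<^sup>2 / 2"
  define A :: "(real^2) set" where
    "A = {vector [?x, s], vector [?x, - s], vector [- ?x, 2 * s], vector [- ?x, - 2 * s]}"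
  have "A \<subseteq> ball 0 e"
    using s s2 by (auto simp: A_def intro!: norm_less_real2)
  moreover have "card A = 4"
    using s by (simp add: A_def vec_eq_iff forall_2)
  moreover have "\<forall>a\<in>A. node_form a = vector [?x\<^sup>2, 5 * s\<^sup>2 / 2]"
    by (auto simp: A_def node_form_def vec_eq_iff forall_2 power2_eq_square)
  ultimately show "\<exists>A y. A \<subseteq> U \<and> card A = 4 \<and> (\<forall>a\<in>A. node_form a = y)"
    using e(2) by blast
qed

text \<open>\<open>cusp_form\<close> commutes with exchanging the coordinates, so a value on the
  diagonal has preimages both on the diagonal and in symmetric pairs. The pairs lie on x + y = 1;
  for the value 3/4 + s^2 the diagonal point solves (x + 1/2)^2 = 1 + s^2, which is where
  \<open>r\<close> comes from.\<close>

lemma locally_multiple_cusp_form: "locally_multiple 3 cusp_form (vector [1/2, 1/2])"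
  unfolding locally_multiple_def
proof (intro allI impI)
  fix U :: "(real^2) set" assume "open U \<and> vector [1/2, 1/2] \<in> U"
  then obtain e where e: "e > 0" "ball (vector [1/2, 1/2]) e \<subseteq> U" using open_contains_ball by blast
  define s where "s = e / 4"
  have s: "s > 0" "4 * s \<le> e" using e(1) by (auto simp: s_def)
  define r where "r = sqrt (1 + s\<^sup>2) - 1"
  have r_sq: "(1 + r)\<^sup>2 = 1 + s\<^sup>2" by (simp add: r_def)
  have r0: "r \<ge> 0" by (simp add: r_def)
  have "(1 + r)\<^sup>2 \<le> (1 + s)\<^sup>2" using s unfolding r_sq by (simp add: power2_sum)
  then have rs: "r \<le> s" using s power2_le_imp_le[of "1 + r" "1 + s"] by simp
  define A :: "(real^2) set" where
    "A = {vector [1/2 + s, 1/2 - s], vector [1/2 - s, 1/2 + s], vector [1/2 + r, 1/2 + r]}"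
  have "A \<subseteq> ball (vector [1/2, 1/2]) e"
    using s rs r0 by (auto simp: A_def dist_norm intro!: norm_less_real2)
  moreover have "card A = 3"
    using s r0 by (simp add: A_def vec_eq_iff forall_2)
  moreover have "\<forall>a\<in>A. cusp_form a = vector [3/4 + s\<^sup>2, 3/4 + s\<^sup>2]"
    using r_sq by (auto simp: A_def cusp_form_def vec_eq_iff forall_2 power2_eq_square algebra_simps)
  ultimately show "\<exists>A y. A \<subseteq> U \<and> card A = 3 \<and> (\<forall>a\<in>A. cusp_form a = y)"
    using e(2) by blast
qed

text \<open>Vieta for vanishing cubic and unit linear coefficient: after eliminating d, the third
  symmetric function becomes -(a + b)(a + c)(b + c). The facts \<open>1\<close> and \<open>2\<close>
  are first and second divided differences of the quartic, whose vanishing uses that the roots are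
  distinct.\<close>

lemma quartic_four_roots:
  fixes a b c d p q :: real
  assumes "\<And>x. x \<in> {a, b, c, d} \<Longrightarrow> x ^ 4 + p * x\<^sup>2 + x + q = 0"
    and "a \<noteq> b" "a \<noteq> c" "a \<noteq> d" "b \<noteq> c" "b \<noteq> d" "c \<noteq> d"
  shows "a + b + c + d = 0" "(a + b) * (a * b + a * c + b * c + c\<^sup>2) = 1"
proof -
  have 1: "(x + y) * (x\<^sup>2 + y\<^sup>2) + p * (x + y) + 1 = 0"
    if "x \<in> {a, b, c, d}" "y \<in> {a, b, c, d}" "x \<noteq> y" for x y
  proof -
    have "(x - y) * ((x + y) * (x\<^sup>2 + y\<^sup>2) + p * (x + y) + 1) =
        (x ^ 4 + p * x\<^sup>2 + x + q) - (y ^ 4 + p * y\<^sup>2 + y + q)"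
      by algebra
    then show ?thesis using assms(1)[OF that(1)] assms(1)[OF that(2)] that(3) by simp
  qed
  have 2: "a\<^sup>2 + b\<^sup>2 + x\<^sup>2 + a * b + a * x + b * x + p = 0" if "x = c \<or> x = d" for x
  proof -
    have "(b - x) * (a\<^sup>2 + b\<^sup>2 + x\<^sup>2 + a * b + a * x + b * x + p) =
        ((a + b) * (a\<^sup>2 + b\<^sup>2) + p * (a + b) + 1) - ((a + x) * (a\<^sup>2 + x\<^sup>2) + p * (a + x) + 1)"
      by algebra
    also have "\<dots> = 0" using 1[of a b] 1[of a x] assms(2-4) that by auto
    finally show ?thesis using assms(5,6) that by auto
  qed
  have "(c - d) * (a + b + c + d) = 0" using 2[OF disjI1[OF refl]] 2[OF disjI2[OF refl]] by algebra
  then show "a + b + c + d = 0" using assms by simp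
  show "(a + b) * (a * b + a * c + b * c + c\<^sup>2) = 1"
    using 2[OF disjI1[OF refl]] 1[of a b] assms(2) by simp algebra
qed

text \<open>Four nearby preimages would give four nearby roots of a quartic with vanishing cubic coefficient,
  hence four roots near \<open>0\<close>, which contradicts the linear coefficient \<open>1\<close>.\<close>

lemma not_locally_multiple_cusp_form: "\<not> locally_multiple 4 cusp_form x"
proof
  assume mult: "locally_multiple 4 cusp_form x"
  \<comment> \<open>The value and the first coordinate determine the second, so a strip suffices.
    Four roots within 1/8 of a common centre and with sum 0 force the centre below 1/8 and the roots
    below 1/4 in absolute value; the product that should be 1 is then at most 1/8.\<close>
  let ?U = "{z::real^2. \<bar>z $ 1 - x $ 1\<bar> < 1/8}"
  have "open ?U" by (intro open_Collect_less continuous_intros)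
  then obtain A y where A: "A \<subseteq> ?U" "card A = 4" "\<forall>a\<in>A. cusp_form a = y"
    using mult[unfolded locally_multiple_def, rule_format, of ?U] by auto
  have root: "(z $ 1) ^ 4 + (- 2 * y $ 1) * (z $ 1)\<^sup>2 + z $ 1 + ((y $ 1)\<^sup>2 - y $ 2) = 0"
    and z2: "z $ 2 = y $ 1 - (z $ 1)\<^sup>2" if "z \<in> A" for z
  proof -
    have "y $ 1 = (z $ 1)\<^sup>2 + z $ 2" "y $ 2 = (z $ 2)\<^sup>2 + z $ 1"
      using A(3) that by (auto simp: cusp_form_def)
    then show "(z $ 1) ^ 4 + (- 2 * y $ 1) * (z $ 1)\<^sup>2 + z $ 1 + ((y $ 1)\<^sup>2 - y $ 2) = 0"
      "z $ 2 = y $ 1 - (z $ 1)\<^sup>2" by algebra+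
  qed
  have inj: "inj_on (\<lambda>z. z $ 1) A"
    using z2 by (auto simp: inj_on_def vec_eq_iff forall_2)
  let ?R = "(\<lambda>z. z $ 1) ` A"
  have "card ?R = Suc 3" using inj A(2) by (simp add: card_image)
  then obtain a R where R: "?R = insert a R" "a \<notin> R" "card R = 3"
    unfolding card_Suc_eq by blast
  then obtain b c d where bcd: "R = {b, c, d}" "b \<noteq> c" "b \<noteq> d" "c \<noteq> d"
    by (auto simp: card_3_iff)
  have "r ^ 4 + (- 2 * y $ 1) * r\<^sup>2 + r + ((y $ 1)\<^sup>2 - y $ 2) = 0" if "r \<in> {a, b, c, d}" for r
  proof -
    have "r \<in> ?R" using that R(1) bcd(1) by simp
    then obtain z where "z \<in> A" "r = z $ 1" by blast
    then show ?thesis using root[of z] by simp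
  qed
  then have e: "a + b + c + d = 0" "(a + b) * (a * b + a * c + b * c + c\<^sup>2) = 1"
    using quartic_four_roots[of a b c d "- 2 * y $ 1" "(y $ 1)\<^sup>2 - y $ 2"] R(2) bcd by auto
  have near: "\<bar>r - x $ 1\<bar> < 1/8" if "r \<in> {a, b, c, d}" for r
  proof -
    have "r \<in> ?R" using that R(1) bcd(1) by simp
    then show ?thesis using A(1) by blast
  qed
  have small: "\<bar>a\<bar> \<le> 1/4" "\<bar>b\<bar> \<le> 1/4" "\<bar>c\<bar> \<le> 1/4"
    using e(1) near[of a] near[of b] near[of c] near[of d] unfolding abs_less_iff abs_le_iff
    by (simp_all only: insert_iff simp_thms True_implies_equals, linarith+)
  have prod: "\<bar>r * s\<bar> \<le> 1/16" if "\<bar>r\<bar> \<le> 1/4" "\<bar>s\<bar> \<le> 1/4" for r s :: real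
    using mult_mono[OF that] by (simp add: abs_mult)
  have "\<bar>a * b + a * c + b * c + c\<^sup>2\<bar> \<le> 1/4"
    using prod[OF small(1,2)] prod[OF small(1,3)] prod[OF small(2,3)] prod[OF small(3,3)]
    unfolding power2_eq_square by linarith
  moreover have "\<bar>a + b\<bar> \<le> 1/2" using small by linarith
  ultimately have "\<bar>a + b\<bar> * \<bar>a * b + a * c + b * c + c\<^sup>2\<bar> \<le> 1/2 * (1/4)"
    by (intro mult_mono) auto
  then show False using e(2) by (simp add: abs_mult[symmetric])
qed

text \<open>Completing the square: x y^2 + y^4 = (y^2 + x/2)^2 - x^2/4. The source change makes y^2
  + x/2 a coordinate up to sign, and the target change subtracts the known x^2/4.\<close>

lemma A_equivalent_node_form_node_model: "A_equivalent UNIV UNIV node_form UNIV UNIV node_model"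
proof -
  let ?\<Phi> = "\<lambda>z::real^2. vector [- z $ 1 / 2 - (z $ 2)\<^sup>2, z $ 2] :: real^2"
  let ?\<Psi> = "\<lambda>p::real^2. vector [- 2 * p $ 2, p $ 1 - (p $ 2)\<^sup>2] :: real^2"
  have "diffeomorphism UNIV UNIV ?\<Phi>"
    by (rule diffeomorphismI[where g = "\<lambda>z. vector [- 2 * (z $ 1 + (z $ 2)\<^sup>2), z $ 2]"];
        (intro smooth_intros open_UNIV)?; simp add: vec_eq_iff forall_2 field_simps)
  moreover have "diffeomorphism UNIV UNIV ?\<Psi>"
    by (rule diffeomorphismI[where g = "\<lambda>p. vector [p $ 2 + (p $ 1)\<^sup>2 / 4, - p $ 1 / 2]"];
        (intro smooth_intros open_UNIV)?; simp add: vec_eq_iff forall_2 power2_eq_square)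
  moreover have "?\<Psi> (node_form (?\<Phi> z)) = node_model z" for z
    by (simp add: node_form_def node_model_def vec_eq_iff forall_2 power2_eq_square
        power4_eq_xxxx field_simps)
  ultimately show ?thesis
    unfolding A_equivalent_def using smooth_node_form smooth_node_model
    by (auto simp: smooth_map_def)
qed

section \<open>The three types\<close>

lemma is_line_iff: "is_line L \<longleftrightarrow> (\<exists>c d. d \<noteq> 0 \<and> L = range (\<lambda>t. c + t *\<^sub>R d))"
proof
  assume "is_line L"
  then obtain a b where ab: "a \<noteq> b" "L = affine hull {a, b}" unfolding is_line_def by blast
  then have "L = range (\<lambda>t. a + t *\<^sub>R (b - a))" by (auto simp: affine_hull_2_alt)
  then show "\<exists>c d. d \<noteq> 0 \<and> L = range (\<lambda>t. c + t *\<^sub>R d)" using ab(1) by (metis right_minus_eq)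
next
  assume "\<exists>c d. d \<noteq> 0 \<and> L = range (\<lambda>t. c + t *\<^sub>R d)"
  then obtain c d where cd: "d \<noteq> 0" "L = range (\<lambda>t. c + t *\<^sub>R d)" by blast
  then have "c \<noteq> c + d" "L = affine hull {c, c + d}" by (auto simp: affine_hull_2_alt)
  then show "is_line L" unfolding is_line_def by blast
qed

lemma orthonormal_basis_real2:
  fixes u v d :: "real^2"
  assumes "norm u = 1" "norm v = 1" "u \<bullet> v = 0" "d \<bullet> u = 0" "d \<bullet> v = 0"
  shows "d = 0"
proof -
  have 1: "u$1 * u$1 + u$2 * u$2 = 1" "v$1 * v$1 + v$2 * v$2 = 1" "u$1 * v$1 + u$2 * v$2 = 0"
    "d$1 * u$1 + d$2 * u$2 = 0" "d$1 * v$1 + d$2 * v$2 = 0"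
    using assms unfolding norm_eq_1 by (simp_all add: inner_vec_def sum_2)
  \<comment> \<open>Lagrange's identity: the squared determinant is the Gram determinant of an
    orthonormal pair.\<close>
  have "(u$1 * v$2 - u$2 * v$1)\<^sup>2 = 1" using 1(1-3) by algebra
  moreover have "(u$1 * v$2 - u$2 * v$1) * d$1 = 0" "(u$1 * v$2 - u$2 * v$1) * d$2 = 0"
    using 1(4,5) by algebra+
  ultimately show ?thesis by (auto simp: vec_eq_iff forall_2)
qed

text \<open>Separates type 1 from the other two, whose singular sets contain a line. Along a line
  the equation is a polynomial in t of degree at most two and constantly 1; the values at 0, 1 and
  -1 give its coefficients, and these force the direction to vanish.\<close>

lemma hyperbola_contains_no_line:
  assumes "is_hyperbola H" "is_line L"
  shows "\<not> L \<subseteq> H"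
proof
  assume sub: "L \<subseteq> H"
  obtain c u v a b where uv: "norm u = 1" "norm v = 1" "u \<bullet> v = 0" and ab: "a > 0" "b > 0"
    and H: "H = {x. (((x - c) \<bullet> u) / a)\<^sup>2 - (((x - c) \<bullet> v) / b)\<^sup>2 = 1}"
    using assms(1) unfolding is_hyperbola_def by blast
  obtain p d where d: "d \<noteq> 0" and L: "L = range (\<lambda>t. p + t *\<^sub>R d)"
    using assms(2) unfolding is_line_iff by blast
  define P Q A B where "P = (p - c) \<bullet> u / a" and "Q = (p - c) \<bullet> v / b"
    and "A = d \<bullet> u / a" and "B = d \<bullet> v / b"
  have eq: "(P + t * A)\<^sup>2 - (Q + t * B)\<^sup>2 = 1" for t
  proof -
    have "p + t *\<^sub>R d \<in> H" using sub L by blast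
    then show ?thesis
      by (simp add: H P_def Q_def A_def B_def inner_add_left inner_diff_left add_divide_distrib
          diff_divide_distrib algebra_simps)
  qed
  have 1: "P\<^sup>2 - Q\<^sup>2 = 1" "A\<^sup>2 = B\<^sup>2" "A * P = B * Q"
    using eq[of 0] eq[of 1] eq[of "-1"] by (simp_all add: power2_eq_square algebra_simps)
  have "A\<^sup>2 * (P\<^sup>2 - Q\<^sup>2) = 0" using 1(2,3) by algebra
  then have "A = 0" "B = 0" using 1(1,2) by auto
  then have "d \<bullet> u = 0" "d \<bullet> v = 0" using ab by (auto simp: A_def B_def)
  then show False using orthonormal_basis_real2[OF uv] d by blast
qed

text \<open>Rescaling the two factors to gradients of equal length makes the gradients of their sum and
  difference orthogonal.\<close>

lemma is_hyperbola_product: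
  fixes n m c :: "real^2"
  assumes det: "n $ 1 * m $ 2 - n $ 2 * m $ 1 \<noteq> 0"
  shows "is_hyperbola {x. 4 * (n \<bullet> (x - c)) * (m \<bullet> (x - c)) = 1}"
proof -
  have nz: "norm n > 0" "norm m > 0" using det by auto
  define k where "k = sqrt (norm m / norm n)"
  have k: "k > 0" "k\<^sup>2 = norm m / norm n" using nz by (simp_all add: k_def)
  define p q where "p = k *\<^sub>R n + (1 / k) *\<^sub>R m" and "q = k *\<^sub>R n - (1 / k) *\<^sub>R m"
  have indep: "r *\<^sub>R n + s *\<^sub>R m \<noteq> 0" if "s \<noteq> 0" for r s
  proof
    assume "r *\<^sub>R n + s *\<^sub>R m = 0"
    then have "r * n $ 1 + s * m $ 1 = 0" "r * n $ 2 + s * m $ 2 = 0"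
      by (auto simp: vec_eq_iff forall_2)
    then have "s * (n $ 1 * m $ 2 - n $ 2 * m $ 1) = 0" by algebra
    then show False using that det by simp
  qed
  have pq0: "norm p > 0" "norm q > 0"
    using indep[of "1 / k" k] indep[of "- (1 / k)" k] k by (auto simp: p_def q_def)
  have "p \<bullet> q = k\<^sup>2 * (n \<bullet> n) - (m \<bullet> m) / k\<^sup>2"
    using k(1) by (simp add: p_def q_def inner_simps inner_commute power2_eq_square field_simps)
  also have "\<dots> = 0"
    using nz unfolding k(2) power2_norm_eq_inner[symmetric]
    by (simp add: power2_eq_square field_simps)
  finally have orth: "p \<bullet> q = 0" .
  have "(y \<bullet> p)\<^sup>2 - (y \<bullet> q)\<^sup>2 = 4 * (n \<bullet> y) * (m \<bullet> y)" for y
    using k(1) by (simp add: p_def q_def inner_simps inner_commute power2_eq_square field_simps)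
  moreover have "(y \<bullet> (r /\<^sub>R norm r)) / (1 / norm r) = y \<bullet> r" if "norm r > 0" for y r :: "real^2"
    using that by (simp add: field_simps)
  ultimately have "{x. 4 * (n \<bullet> (x - c)) * (m \<bullet> (x - c)) = 1} =
      {x. (((x - c) \<bullet> (p /\<^sub>R norm p)) / (1 / norm p))\<^sup>2 -
          (((x - c) \<bullet> (q /\<^sub>R norm q)) / (1 / norm q))\<^sup>2 = 1}"
    using pq0 by (simp only:)
  moreover have "norm (p /\<^sub>R norm p) = 1" "norm (q /\<^sub>R norm q) = 1"
    "(p /\<^sub>R norm p) \<bullet> (q /\<^sub>R norm q) = 0" "1 / norm p > 0" "1 / norm q > 0"
    using pq0 orth by simp_all
  ultimately show ?thesis unfolding is_hyperbola_def by blast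
qed

text \<open>Regularity can be tested on one smooth function: if the velocity of the curve vanished,
  \<open>h\<close> along the curve would be stationary as well.\<close>

lemma smooth_curve_chain_rule:
  fixes \<gamma> :: "real \<Rightarrow> real^2" and h :: "real^2 \<Rightarrow> real"
  assumes \<gamma>: "smooth_on UNIV \<gamma>" and h: "smooth_on T h" "range \<gamma> \<subseteq> T"
    and k: "\<And>t. h (\<gamma> t) = k t" "(k has_real_derivative k') (at t)" "k' \<noteq> 0"
  shows "vector_derivative \<gamma> (at t) \<noteq> 0"
proof
  assume 0: "vector_derivative \<gamma> (at t) = 0"
  have "\<gamma> differentiable (at t)"
    using smooth_on_has_derivative[OF \<gamma>] differentiableI by blast
  then have \<gamma>': "(\<gamma> has_derivative (\<lambda>x. x *\<^sub>R 0)) (at t)"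
    using 0 vector_derivative_works unfolding has_vector_derivative_def by metis
  obtain h' where "(h has_derivative h') (at (\<gamma> t))"
    using smooth_on_has_derivative[OF h(1)] h(2) by blast
  then have "((h \<circ> \<gamma>) has_derivative (h' \<circ> (\<lambda>x. x *\<^sub>R 0))) (at t)" "linear h'"
    using diff_chain_at[OF \<gamma>'] has_derivative_linear by blast+
  then have "(k has_derivative (\<lambda>x. 0)) (at t)"
    using k(1) by (simp add: comp_def linear_0)
  then have "(k has_real_derivative 0) (at t)"
    by (simp add: has_field_derivative_def lambda_zero[symmetric])
  then show False using k(2,3) DERIV_unique by blast
qed

text \<open>A smooth left inverse certifies both the nonzero velocity and the continuity of the
  inverse on the image.\<close>

lemma smooth_curveI:
  fixes \<gamma> :: "real \<Rightarrow> real^2" and h :: "real^2 \<Rightarrow> real"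
  assumes \<gamma>: "smooth_on UNIV \<gamma>" and h: "smooth_on T h" "range \<gamma> \<subseteq> T" "\<And>t. h (\<gamma> t) = t"
  shows "smooth_curve \<gamma>"
proof -
  have "vector_derivative \<gamma> (at t) \<noteq> 0" for t
    by (rule smooth_curve_chain_rule[OF \<gamma> h DERIV_ident]) simp
  moreover have "homeomorphism UNIV (range \<gamma>) \<gamma> h"
    using smooth_on_imp_continuous_on[OF \<gamma>]
      continuous_on_subset[OF smooth_on_imp_continuous_on[OF h(1)] h(2)] h(3)
    by (auto simp: homeomorphism_def image_iff)
  ultimately show ?thesis unfolding smooth_curve_def using \<gamma> by blast
qed

text \<open>By evenness only t^2 can be recovered from a point; its root inverts the curve on the
  half-line, and the derivative 2t explains why t = 0 is exempt.\<close>

lemma double_point_curveI: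
  fixes \<delta> :: "real \<Rightarrow> real^2" and h :: "real^2 \<Rightarrow> real"
  assumes \<delta>: "smooth_on UNIV \<delta>" "\<And>t. \<delta> (- t) = \<delta> t"
    and h: "smooth_on T h" "range \<delta> \<subseteq> T" "\<And>t. h (\<delta> t) = t\<^sup>2"
  shows "double_point_curve \<delta>"
proof -
  have "vector_derivative \<delta> (at t) \<noteq> 0" if "t \<noteq> 0" for t
    by (rule smooth_curve_chain_rule[OF \<delta>(1) h, of "2 * t"])
      (use that in \<open>auto intro!: derivative_eq_intros\<close>)
  moreover have "homeomorphism {0..} (range \<delta>) \<delta> (\<lambda>y. sqrt (h y))"
  proof (rule homeomorphismI)
    show "continuous_on {0..} \<delta>"
      using smooth_on_imp_continuous_on[OF \<delta>(1)] continuous_on_subset by blast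
    show "continuous_on (range \<delta>) (\<lambda>y. sqrt (h y))"
      using continuous_on_subset[OF smooth_on_imp_continuous_on[OF h(1)] h(2)]
      by (intro continuous_intros)
    show "\<delta> (sqrt (h y)) = y" if "y \<in> range \<delta>" for y
      using that \<delta>(2) by (auto simp: h abs_if)
  qed (auto simp: h)
  ultimately show ?thesis unfolding double_point_curve_def using \<delta> by blast
qed

text \<open>The asymmetry is deliberate: an affine source change keeps the singular set a conic or a
  union of lines, while the target change must accommodate logarithms.\<close>

definition affine_normal_form :: "(real^2 \<Rightarrow> real^2) \<Rightarrow> (real^2 \<Rightarrow> real^2) \<Rightarrow> bool" where
  "affine_normal_form F G \<longleftrightarrow> smooth_map UNIV pos_quadrant F \<and>
     (\<exists>N b \<Psi>. det N \<noteq> 0 \<and> diffeomorphism pos_quadrant UNIV \<Psi> \<and> (\<forall>x. \<Psi> (F x) = G (N *v x + b)))"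

lemma affine_normal_formE:
  assumes "affine_normal_form F G" "smooth_on UNIV G"
  obtains M N :: "real^2^2" and b \<Psi> where "det N \<noteq> 0" "det M \<noteq> 0"
    "\<And>x. M *v (N *v x + b - b) = x" "\<And>z. N *v (M *v (z - b)) + b = z"
    "plane_A_equivalence pos_quadrant F G (\<lambda>z. M *v (z - b)) \<Psi>"
proof -
  obtain N :: "real^2^2" and b \<Psi> where N: "det N \<noteq> 0" and \<Psi>: "diffeomorphism pos_quadrant UNIV \<Psi>"
    and eq: "\<And>x. \<Psi> (F x) = G (N *v x + b)" and F: "smooth_map UNIV pos_quadrant F"
    using assms(1) unfolding affine_normal_form_def by blast
  obtain M where M: "N ** M = mat 1" "M ** N = mat 1"
    using N invertible_det_nz[of N] unfolding invertible_def by blast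
  have MN: "M *v (N *v x) = x" "N *v (M *v x) = x" for x
    by (simp_all add: matrix_vector_mul_assoc M)
  have "det M \<noteq> 0" using M det_mul[of M N] by auto
  have smooth: "smooth_on UNIV (\<lambda>z. A *v z)" for A :: "real^2^2"
    by (intro smooth_on_bounded_linear matrix_vector_mul_bounded_linear open_UNIV)
  have "diffeomorphism UNIV UNIV (\<lambda>z. M *v (z - b))"
  proof (rule diffeomorphismI[where g = "\<lambda>x. N *v x + b"])
    show "smooth_on UNIV (\<lambda>z. M *v (z - b))"
    proof (rule smooth_on_compose[OF open_UNIV open_UNIV _ smooth])
      show "smooth_on UNIV (\<lambda>z. z - b)"
        by (intro smooth_on_diff smooth_on_id smooth_on_const open_UNIV)
    qed simp
    show "smooth_on UNIV (\<lambda>x. N *v x + b)"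
      by (intro smooth_on_add smooth smooth_on_const open_UNIV)
  qed (simp_all add: MN)
  then have "plane_A_equivalence pos_quadrant F G (\<lambda>z. M *v (z - b)) \<Psi>"
    using F assms(2) \<Psi> by unfold_locales (simp_all add: eq MN)
  with N \<open>det M \<noteq> 0\<close> show thesis
    using that[of N M b \<Psi>] by (simp add: MN)
qed

section \<open>From normal forms to types\<close>

lemma affine_normal_form_A_equivalent:
  assumes "affine_normal_form F G" "smooth_on UNIV G"
  shows "A_equivalent UNIV pos_quadrant F UNIV UNIV G"
  using assms by (elim affine_normal_formE plane_A_equivalence.A_equivalent)

lemma type1_if_cusp_form:
  assumes "affine_normal_form F cusp_form"
  shows "type1 F"
proof -
  obtain M N :: "real^2^2" and b \<Psi> where N: "det N \<noteq> 0"
    and MN: "\<And>x. M *v (N *v x + b - b) = x" "\<And>z. N *v (M *v (z - b)) + b = z"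
    and "plane_A_equivalence pos_quadrant F cusp_form (\<lambda>z. M *v (z - b)) \<Psi>"
    using affine_normal_formE[OF assms smooth_cusp_form] by metis
  then interpret plane_A_equivalence pos_quadrant F cusp_form "\<lambda>z. M *v (z - b)" \<Psi> by simp
  let ?p = "vector [1/2, 1/2] :: real^2"
  \<comment> \<open>The point sent to the origin by the affine change, hence the centre of the
    hyperbola.\<close>
  define c where "c = M *v (0 - b)"
  have "N *v c = - b" using MN(2)[of 0] by (simp add: c_def eq_neg_iff_add_eq_0)
  then have coord: "N *v x + b = N *v (x - c)" for x
    by (simp add: matrix_vector_mult_diff_distrib)
  have "singular_set F = {x. 4 * (N *v x + b) $ 1 * (N *v x + b) $ 2 = 1}"
    using singular_iff[of "N *v x + b" for x] unfolding MN(1) singular_set_cusp_form by auto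
  also have "\<dots> = {x. 4 * (N $ 1 \<bullet> (x - c)) * (N $ 2 \<bullet> (x - c)) = 1}"
    unfolding coord by (simp add: matrix_vector_mul_component)
  finally have "is_hyperbola (singular_set F)"
    using N is_hyperbola_product[of "N $ 1" "N $ 2" c] by (simp add: det_2)
  moreover have "{x \<in> singular_set F. \<not> fold_point F x} = {M *v (?p - b)}"
    by (rule nonfold_singular_set_eq[OF locally_multiple_cusp_form])
      (auto simp: singular_set_cusp_form intro: fold_point_cusp_form)
  moreover have "cusp_point F (M *v (?p - b))"
    using germ cusp_point_cusp_form unfolding cusp_point_def by blast
  ultimately show ?thesis unfolding type1_def by blast
qed

lemma image_axis_is_line:
  fixes M :: "real^2^2"
  assumes "det M \<noteq> 0" "i \<noteq> j"
  shows "is_line ((\<lambda>z. M *v (z - b)) ` {z. z $ i = 0})"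
    "(\<lambda>z. M *v (z - b)) ` {z. z $ i = 0} = range (\<lambda>t. M *v (t *\<^sub>R axis j 1 - b))"
proof -
  have eq: "{z::real^2. z $ i = 0} = range (\<lambda>t. t *\<^sub>R axis j 1)"
  proof -
    have "z = z $ j *\<^sub>R axis j 1" if "z $ i = 0" for z :: "real^2"
      using that assms(2) exhaust_2[of i] exhaust_2[of j]
      by (auto simp: vec_eq_iff forall_2 axis_def)
    then show ?thesis using assms(2) by (auto simp: axis_def)
  qed
  then show im: "(\<lambda>z. M *v (z - b)) ` {z. z $ i = 0} = range (\<lambda>t. M *v (t *\<^sub>R axis j 1 - b))"
    by (simp add: image_image)
  have "M *v axis j 1 \<noteq> 0"
  proof
    assume "M *v axis j 1 = 0"
    then have "axis j (1::real) = 0"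
      using assms(1) invertible_det_nz matrix_left_invertible_ker
      by (metis invertible_left_inverse)
    then show False by (simp add: axis_eq_0_iff)
  qed
  moreover have "(\<lambda>t. M *v (t *\<^sub>R axis j 1 - b)) = (\<lambda>t. - (M *v b) + t *\<^sub>R (M *v axis j 1))"
    by (simp add: fun_eq_iff matrix_vector_mult_diff_distrib matrix_vector_mult_scaleR)
  ultimately show "is_line ((\<lambda>z. M *v (z - b)) ` {z. z $ i = 0})"
    unfolding im is_line_iff by metis
qed

lemma type3_if_fold_model:
  assumes "affine_normal_form F fold_model"
  shows "type3 F"
proof -
  obtain M N :: "real^2^2" and b \<Psi> where M: "det M \<noteq> 0"
    and "plane_A_equivalence pos_quadrant F fold_model (\<lambda>z. M *v (z - b)) \<Psi>"
    using affine_normal_formE[OF assms smooth_fold_model] by metis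
  then interpret plane_A_equivalence pos_quadrant F fold_model "\<lambda>z. M *v (z - b)" \<Psi> by simp
  have "is_line (singular_set F)"
    unfolding singular_set_eq singular_set_fold_model
    by (rule image_axis_is_line[OF M, of _ 1]) simp
  moreover have "fold_point F x" if "x \<in> singular_set F" for x
    using that fold_point_fold_model germ unfolding singular_set_eq fold_point_def by blast
  ultimately show ?thesis using A_equivalent unfolding type3_def by blast
qed

lemma type2_if_node_form:
  assumes "affine_normal_form F node_form"
  shows "type2 F"
proof -
  obtain M N :: "real^2^2" and b \<Psi> where M: "det M \<noteq> 0"
    and MN: "\<And>x. M *v (N *v x + b - b) = x" "\<And>z. N *v (M *v (z - b)) + b = z"
    and "plane_A_equivalence pos_quadrant F node_form (\<lambda>z. M *v (z - b)) \<Psi>"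
    using affine_normal_formE[OF assms smooth_node_form] by metis
  then interpret plane_A_equivalence pos_quadrant F node_form "\<lambda>z. M *v (z - b)" \<Psi> by simp
  let ?\<Phi> = "\<lambda>z. M *v (z - b)"
  let ?\<alpha> = "\<lambda>t. ?\<Phi> (t *\<^sub>R axis 1 1)" and ?\<beta> = "\<lambda>t. ?\<Phi> (t *\<^sub>R axis 2 1)"
  let ?L1 = "?\<Phi> ` {z. z $ 2 = 0}" and ?L2 = "?\<Phi> ` {z. z $ 1 = 0}"
  have L: "is_line ?L1" "is_line ?L2" "range ?\<alpha> = ?L1" "range ?\<beta> = ?L2"
    using image_axis_is_line[OF M, of 2 1 b] image_axis_is_line[OF M, of 1 2 b] by auto
  have S: "singular_set F = ?L1 \<union> ?L2"
    unfolding singular_set_eq singular_set_node_form by blast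
  have inj: "inj ?\<Phi>" using inj_on_inverseI[where g = "\<lambda>x. N *v x + b", OF MN(2)] .
  have "?L1 \<inter> ?L2 = ?\<Phi> ` ({z. z $ 2 = 0} \<inter> {z. z $ 1 = 0})"
    by (rule image_Int[OF inj, symmetric])
  also have "{z. z $ 2 = 0} \<inter> {z. z $ 1 = 0} = {0::real^2}"
    by (auto simp: vec_eq_iff forall_2)
  finally have Int: "?L1 \<inter> ?L2 = {?\<Phi> 0}" by simp
  have nonfold: "{x \<in> singular_set F. \<not> fold_point F x} = {?\<Phi> 0}"
    by (rule nonfold_singular_set_eq)
      (auto simp: singular_set_node_form fold_point_node_form
        intro: locally_multiple_mono[OF locally_multiple_node_form])
  have axis: "smooth_on UNIV (\<lambda>t. t *\<^sub>R axis i 1 :: real^2)" for i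
    by (intro smooth_intros open_UNIV)
  have line: "smooth_on UNIV (\<lambda>t. ?\<Phi> (t *\<^sub>R axis i 1))" for i
    by (rule smooth_on_compose[OF open_UNIV open_UNIV _ diffeomorphism_smooth[OF \<Phi>] axis]) simp
  have F_line: "smooth_on UNIV (\<lambda>t. F (?\<Phi> (t *\<^sub>R axis i 1)))" for i
    by (rule smooth_on_compose[OF open_UNIV open_UNIV _ _ line])
      (use F in \<open>auto simp: smooth_map_def\<close>)
  have N: "smooth_on UNIV (\<lambda>x. (N *v x + b) $ i)" for i
    by (intro smooth_on_component smooth_on_add smooth_on_const open_UNIV
        smooth_on_bounded_linear matrix_vector_mul_bounded_linear)
  \<comment> \<open>The second component of \<open>node_form\<close> is t on the axis traced by
    \<open>?\<alpha>\<close> and t^2 on the one traced by \<open>?\<beta>\<close>. This one function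
    certifies both the smooth curve and the double point curve.\<close>
  have \<Psi>2: "smooth_on pos_quadrant (\<lambda>y. \<Psi> y $ 2)"
    by (rule smooth_on_component[OF diffeomorphism_open(1)[OF \<Psi>] diffeomorphism_smooth[OF \<Psi>]])
  have "smooth_curve ?\<alpha>"
    by (rule smooth_curveI[OF line N[of 1]]) (simp_all add: MN axis_def)
  moreover have "smooth_curve ?\<beta>"
    by (rule smooth_curveI[OF line N[of 2]]) (simp_all add: MN axis_def)
  moreover have "smooth_curve (F \<circ> ?\<alpha>)"
    unfolding comp_def
    by (rule smooth_curveI[OF F_line \<Psi>2]) (use F_in in \<open>auto simp: eq node_form_def axis_def\<close>)
  moreover have "double_point_curve (F \<circ> ?\<beta>)"
    unfolding comp_def
  proof (rule double_point_curveI[OF F_line _ \<Psi>2])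
    show "F (?\<Phi> (- t *\<^sub>R axis 2 1)) = F (?\<Phi> (t *\<^sub>R axis 2 1))" for t
      unfolding F_eq by (simp add: node_form_def axis_def)
  qed (use F_in in \<open>auto simp: eq node_form_def axis_def\<close>)
  moreover have "singular_value_set F = range (F \<circ> ?\<alpha>) \<union> range (F \<circ> ?\<beta>)"
    unfolding singular_value_set_def S L(3,4)[symmetric] by (simp add: image_Un image_comp)
  moreover have "A_equivalent UNIV pos_quadrant F UNIV UNIV node_model"
    by (rule A_equivalent_trans[OF A_equivalent A_equivalent_node_form_node_model])
  ultimately show ?thesis
    unfolding type2_def using L S Int nonfold by blast
qed

section \<open>Separation of the normal forms and of the types\<close>

lemma not_A_equivalent_node_model_fold_model:
  "\<not> A_equivalent UNIV UNIV node_model UNIV UNIV fold_model"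
proof
  assume "A_equivalent UNIV UNIV node_model UNIV UNIV fold_model"
  then have "A_equivalent UNIV UNIV node_form UNIV UNIV fold_model"
    by (rule A_equivalent_trans[OF A_equivalent_node_form_node_model])
  then obtain y where "locally_multiple 4 fold_model y"
    using A_equivalent_locally_multiple locally_multiple_node_form by blast
  then show False
    using locally_multiple_mono[of 4 fold_model y 3] not_locally_multiple_fold_model by simp
qed

lemma not_A_equivalent_cusp_form_fold_model:
  "\<not> A_equivalent UNIV UNIV cusp_form UNIV UNIV fold_model"
  using A_equivalent_locally_multiple locally_multiple_cusp_form not_locally_multiple_fold_model
  by blast

lemma not_A_equivalent_node_form_cusp_form:
  "\<not> A_equivalent UNIV UNIV node_form UNIV UNIV cusp_form"
  using A_equivalent_locally_multiple locally_multiple_node_form not_locally_multiple_cusp_form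
  by blast

text \<open>Type 1 is told apart by the shape of the singular set, types 2 and 3 by their
  inequivalent models. Exclusivity later turns the implications from normal forms to types into
  equivalences.\<close>

lemma types_exclusive:
  "\<not> (type1 F \<and> type2 F)" "\<not> (type1 F \<and> type3 F)" "\<not> (type2 F \<and> type3 F)"
proof -
  show "\<not> (type1 F \<and> type2 F)"
    unfolding type1_def type2_def using hyperbola_contains_no_line by (metis Un_upper1)
  show "\<not> (type1 F \<and> type3 F)"
    unfolding type1_def type3_def using hyperbola_contains_no_line by blast
  show "\<not> (type2 F \<and> type3 F)"
    using not_A_equivalent_node_model_fold_model A_equivalent_sym A_equivalent_trans
    unfolding type2_def type3_def by blast
qed

section \<open>Pencils of quadratic forms\<close>

text \<open>The squared Mahalanobis distance when \<open>A\<close> is the inverse covariance matrix: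
  up to an additive constant, -2 times the logarithm of the density.\<close>

definition quad :: "real^2 \<Rightarrow> real^2^2 \<Rightarrow> real^2 \<Rightarrow> real" where
  "quad \<mu> A x = (x - \<mu>) \<bullet> (A *v (x - \<mu>))"

text \<open>Sylvester's criterion in dimension two.\<close>

lemma pos_def_sym_iff:
  "pos_def_sym A \<longleftrightarrow>
    A $ 1 $ 2 = A $ 2 $ 1 \<and> A $ 1 $ 1 > 0 \<and> A $ 1 $ 1 * A $ 2 $ 2 > A $ 1 $ 2 * A $ 1 $ 2"
proof
  assume "pos_def_sym A"
  then have t: "transpose A = A" and pos: "\<And>v. v \<noteq> 0 \<Longrightarrow> v \<bullet> (A *v v) > 0"
    by (auto simp: pos_def_sym_def)
  have sym: "A $ 1 $ 2 = A $ 2 $ 1"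
    using arg_cong[OF t, of "\<lambda>B. B $ 2 $ 1"] by (simp add: transpose_def)
  have 1: "A $ 1 $ 1 > 0"
    using pos[of "vector [1, 0]"]
    by (simp add: vec_eq_iff forall_2 inner_vec_def matrix_vector_mult_def sum_2)
  \<comment> \<open>A maps this vector to (0, det A), so the form takes the value
    \<open>A $ 1 $ 1\<close> times det A on it.\<close>
  let ?v = "vector [- A $ 1 $ 2, A $ 1 $ 1] :: real^2"
  have "?v \<bullet> (A *v ?v) = A $ 1 $ 1 * (A $ 1 $ 1 * A $ 2 $ 2 - A $ 1 $ 2 * A $ 1 $ 2)"
    using sym by (simp add: inner_vec_def matrix_vector_mult_def sum_2 algebra_simps)
  moreover have "?v \<noteq> 0" using 1 by (auto simp: vec_eq_iff forall_2)
  ultimately show "A $ 1 $ 2 = A $ 2 $ 1 \<and> A $ 1 $ 1 > 0 \<and>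
      A $ 1 $ 1 * A $ 2 $ 2 > A $ 1 $ 2 * A $ 1 $ 2"
    using sym 1 pos[of ?v] by (simp add: zero_less_mult_iff)
next
  assume A: "A $ 1 $ 2 = A $ 2 $ 1 \<and> A $ 1 $ 1 > 0 \<and> A $ 1 $ 1 * A $ 2 $ 2 > A $ 1 $ 2 * A $ 1 $ 2"
  have "v \<bullet> (A *v v) > 0" if "v \<noteq> 0" for v
  proof -
    let ?D = "A $ 1 $ 1 * A $ 2 $ 2 - A $ 1 $ 2 * A $ 1 $ 2"
    have "A $ 1 $ 1 * (v \<bullet> (A *v v)) = (A $ 1 $ 1 * v $ 1 + A $ 1 $ 2 * v $ 2)\<^sup>2 + ?D * (v $ 2)\<^sup>2"
      using A by (simp add: inner_vec_def matrix_vector_mult_def sum_2 power2_eq_square algebra_simps)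
    also have "\<dots> > 0"
    proof (cases "v $ 2 = 0")
      case True
      then have "v $ 1 \<noteq> 0" using that by (auto simp: vec_eq_iff forall_2)
      then show ?thesis using True A by simp
    next
      case False
      then show ?thesis using A by (intro add_nonneg_pos mult_pos_pos) auto
    qed
    finally show ?thesis using A by (simp add: zero_less_mult_iff)
  qed
  then show "pos_def_sym A"
    using A unfolding pos_def_sym_def transpose_def by (simp add: vec_eq_iff forall_2)
qed

lemma matrix_inv_inverse:
  "invertible A \<Longrightarrow> A ** matrix_inv A = mat 1 \<and> matrix_inv A ** A = mat 1"
  unfolding invertible_def matrix_inv_def by (rule someI_ex)

text \<open>Writing v = A w turns the form of the inverse at v into the form of A at w. That
  inversion is an involution allows examples to prescribe the inverse covariance matrix.\<close>

lemma pos_def_sym_matrix_inv: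
  assumes A: "pos_def_sym A"
  shows "pos_def_sym (matrix_inv A)" "matrix_inv (matrix_inv A) = A" "det A > 0"
proof -
  show det: "det A > 0" using A by (auto simp: pos_def_sym_iff det_2)
  let ?B = "matrix_inv A"
  have "invertible A" using det by (simp add: invertible_det_nz)
  then have AB: "A ** ?B = mat 1" and BA: "?B ** A = mat 1"
    using matrix_inv_inverse by blast+
  then have "?B ** matrix_inv ?B = mat 1"
    using matrix_inv_inverse[of ?B] unfolding invertible_def by blast
  then show "matrix_inv ?B = A"
    using AB by (metis matrix_mul_assoc matrix_mul_lid matrix_mul_rid)
  have "A ** transpose ?B = mat 1"
    using arg_cong[OF BA, of transpose] A
    by (simp add: matrix_transpose_mul transpose_mat pos_def_sym_def)
  then have "transpose ?B = ?B"
    using BA by (metis matrix_mul_assoc matrix_mul_lid matrix_mul_rid)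
  moreover have "v \<bullet> (?B *v v) > 0" if "v \<noteq> 0" for v
  proof -
    have v: "A *v (?B *v v) = v" by (simp add: matrix_vector_mul_assoc AB)
    then have "?B *v v \<noteq> 0" using that by auto
    then have "(?B *v v) \<bullet> (A *v (?B *v v)) > 0" using A by (simp add: pos_def_sym_def)
    then show ?thesis by (simp add: v inner_commute)
  qed
  ultimately show "pos_def_sym ?B" by (simp add: pos_def_sym_def)
qed

text \<open>Dividing by the normalizing constants before taking -2 ln leaves exactly the quadratic
  functions.\<close>

lemma binormal_pair_log_coordinates:
  assumes "pos_def_sym \<Sigma>1" "pos_def_sym \<Sigma>2"
  shows "smooth_map UNIV pos_quadrant (binormal_pair \<mu>1 \<Sigma>1 \<mu>2 \<Sigma>2)"
    and "\<exists>\<Lambda>::real^2 \<Rightarrow> real^2. diffeomorphism pos_quadrant UNIV \<Lambda> \<and>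
      (\<forall>x. \<Lambda> (binormal_pair \<mu>1 \<Sigma>1 \<mu>2 \<Sigma>2 x) =
        vector [quad \<mu>1 (matrix_inv \<Sigma>1) x, quad \<mu>2 (matrix_inv \<Sigma>2) x])"
proof -
  define k1 k2 where "k1 = 1 / (2 * pi * sqrt (det \<Sigma>1))" and "k2 = 1 / (2 * pi * sqrt (det \<Sigma>2))"
  have k: "k1 > 0" "k2 > 0"
    using assms[THEN pos_def_sym_matrix_inv(3)] by (simp_all add: k1_def k2_def)
  let ?Q1 = "quad \<mu>1 (matrix_inv \<Sigma>1)" and ?Q2 = "quad \<mu>2 (matrix_inv \<Sigma>2)"
  have F: "binormal_pair \<mu>1 \<Sigma>1 \<mu>2 \<Sigma>2 x =
      vector [k1 * exp (- (1/2) * ?Q1 x), k2 * exp (- (1/2) * ?Q2 x)]" for x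
    by (simp add: binormal_pair_def binormal_density_def quad_def k1_def k2_def)
  have quad: "smooth_on UNIV (quad \<mu> A)" for \<mu> A
    unfolding quad_def inner_vec_def matrix_vector_mult_def sum_2 inner_real_def
    by (simp add: sum_2) (intro smooth_intros open_UNIV)
  show "smooth_map UNIV pos_quadrant (binormal_pair \<mu>1 \<Sigma>1 \<mu>2 \<Sigma>2)"
    unfolding smooth_map_def
  proof
    show "smooth_on UNIV (binormal_pair \<mu>1 \<Sigma>1 \<mu>2 \<Sigma>2)"
      unfolding F[abs_def] by (intro smooth_intros open_UNIV quad)
    show "range (binormal_pair \<mu>1 \<Sigma>1 \<mu>2 \<Sigma>2) \<subseteq> pos_quadrant"
      using k by (auto simp: F pos_quadrant_def)
  qed
  let ?\<Lambda> = "\<lambda>z::real^2. vector [- 2 * ln (z $ 1 / k1), - 2 * ln (z $ 2 / k2)] :: real^2"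
  let ?E = "\<lambda>z::real^2. vector [k1 * exp (- (1/2) * z $ 1), k2 * exp (- (1/2) * z $ 2)] :: real^2"
  have "open pos_quadrant"
    unfolding pos_quadrant_def by (intro open_Collect_conj open_Collect_less continuous_intros)
  moreover from this have "smooth_on pos_quadrant ?\<Lambda>"
    by (intro smooth_intros) (use k in \<open>auto simp: pos_quadrant_def\<close>)
  moreover have "smooth_on UNIV ?E" by (intro smooth_intros open_UNIV)
  ultimately have "diffeomorphism pos_quadrant UNIV ?\<Lambda>"
    using k by (intro diffeomorphismI[where g = ?E])
      (auto simp: pos_quadrant_def vec_eq_iff forall_2)
  moreover have "?\<Lambda> (binormal_pair \<mu>1 \<Sigma>1 \<mu>2 \<Sigma>2 x) = vector [?Q1 x, ?Q2 x]" for x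
    using k by (simp add: F)
  ultimately show "\<exists>\<Lambda>::real^2 \<Rightarrow> real^2. diffeomorphism pos_quadrant UNIV \<Lambda> \<and>
      (\<forall>x. \<Lambda> (binormal_pair \<mu>1 \<Sigma>1 \<mu>2 \<Sigma>2 x) = vector [?Q1 x, ?Q2 x])"
    by blast
qed

lemma affine_normal_form_binormal_pairI:
  fixes n m :: "real^2" and G :: "real^2 \<Rightarrow> real^2"
  assumes \<Sigma>: "pos_def_sym \<Sigma>1" "pos_def_sym \<Sigma>2" and \<Psi>: "diffeomorphism UNIV UNIV (\<Psi> :: real^2 \<Rightarrow> real^2)"
    and nm: "n $ 1 * m $ 2 - n $ 2 * m $ 1 \<noteq> 0"
    and eq: "\<And>x. \<Psi> (vector [quad \<mu>1 (matrix_inv \<Sigma>1) x, quad \<mu>2 (matrix_inv \<Sigma>2) x]) =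
      G (vector [n \<bullet> x + e, m \<bullet> x + f])"
  shows "affine_normal_form (binormal_pair \<mu>1 \<Sigma>1 \<mu>2 \<Sigma>2) G"
proof -
  obtain \<Lambda> :: "real^2 \<Rightarrow> real^2" where \<Lambda>: "diffeomorphism pos_quadrant UNIV \<Lambda>"
    and \<Lambda>_eq: "\<And>x. \<Lambda> (binormal_pair \<mu>1 \<Sigma>1 \<mu>2 \<Sigma>2 x) =
        vector [quad \<mu>1 (matrix_inv \<Sigma>1) x, quad \<mu>2 (matrix_inv \<Sigma>2) x]"
    using binormal_pair_log_coordinates(2)[OF \<Sigma>, of \<mu>1 \<mu>2] by blast
  let ?N = "vector [n, m] :: real^2^2"
  have "?N *v x + vector [e, f] = vector [n \<bullet> x + e, m \<bullet> x + f]" for x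
    by (simp add: vec_eq_iff forall_2 matrix_vector_mul_component)
  then have "\<Psi> (\<Lambda> (binormal_pair \<mu>1 \<Sigma>1 \<mu>2 \<Sigma>2 x)) = G (?N *v x + vector [e, f])" for x
    by (simp add: \<Lambda>_eq eq)
  moreover have "det ?N \<noteq> 0" using nm by (simp add: det_2)
  ultimately show ?thesis
    unfolding affine_normal_form_def
    using binormal_pair_log_coordinates(1)[OF \<Sigma>] diffeomorphism_compose[OF \<Lambda> \<Psi>] by blast
qed

lemma affine_diffeomorphism:
  fixes a b c d e f :: real
  assumes "a * d - b * c \<noteq> 0"
  shows "diffeomorphism UNIV UNIV
    (\<lambda>z::real^2. vector [a * z $ 1 + b * z $ 2 + e, c * z $ 1 + d * z $ 2 + f] :: real^2)"
proof (rule diffeomorphismI)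
  let ?g = "\<lambda>z::real^2. vector
    [(d * (z $ 1 - e) - b * (z $ 2 - f)) / (a * d - b * c),
     (a * (z $ 2 - f) - c * (z $ 1 - e)) / (a * d - b * c)] :: real^2"
  let ?f = "\<lambda>z::real^2. vector [a * z $ 1 + b * z $ 2 + e, c * z $ 1 + d * z $ 2 + f] :: real^2"
  show "smooth_on UNIV ?f" by (intro smooth_intros open_UNIV)
  show "smooth_on UNIV ?g" by (intro smooth_intros open_UNIV assms)
  show "?g (?f z) = z" for z
    using assms by (simp add: vec_eq_iff forall_2 divide_eq_eq algebra_simps)
  show "?f (?g z) = z" for z
  proof -
    have "a * ((d * x - b * y) / (a * d - b * c)) + b * ((a * y - c * x) / (a * d - b * c)) = x"
      "c * ((d * x - b * y) / (a * d - b * c)) + d * ((a * y - c * x) / (a * d - b * c)) = y" for x y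
      using assms by (simp_all add: add_divide_distrib[symmetric] divide_eq_eq algebra_simps)
    then show ?thesis by (simp add: vec_eq_iff forall_2)
  qed
qed simp_all

text \<open>Since l1 and l2 differ, the two combinations are linear coordinates of the target, and
  n, m are linear coordinates of the source. Only constants and the sizes of the cross coefficients
  \<alpha>, \<beta> remain to be normalized, by translation and scaling.\<close>

lemma affine_normal_form_of_pencil:
  fixes n m :: "real^2" and \<alpha> \<beta> e f c1 c2 l1 l2 :: real
  assumes \<Sigma>: "pos_def_sym \<Sigma>1" "pos_def_sym \<Sigma>2"
    and l: "l1 \<noteq> l2" and nm: "n $ 1 * m $ 2 - n $ 2 * m $ 1 \<noteq> 0"
    and U: "\<And>x. quad \<mu>2 (matrix_inv \<Sigma>2) x - l1 * quad \<mu>1 (matrix_inv \<Sigma>1) x =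
      (n \<bullet> x + e)\<^sup>2 + \<beta> * (m \<bullet> x + f) + c1"
    and V: "\<And>x. l2 * quad \<mu>1 (matrix_inv \<Sigma>1) x - quad \<mu>2 (matrix_inv \<Sigma>2) x =
      (m \<bullet> x + f)\<^sup>2 + \<alpha> * (n \<bullet> x + e) + c2"
  shows "\<alpha> \<noteq> 0 \<Longrightarrow> \<beta> \<noteq> 0 \<Longrightarrow> affine_normal_form (binormal_pair \<mu>1 \<Sigma>1 \<mu>2 \<Sigma>2) cusp_form"
    and "\<alpha> \<noteq> 0 \<Longrightarrow> \<beta> = 0 \<Longrightarrow> affine_normal_form (binormal_pair \<mu>1 \<Sigma>1 \<mu>2 \<Sigma>2) node_form"
    and "\<alpha> = 0 \<Longrightarrow> \<beta> \<noteq> 0 \<Longrightarrow> affine_normal_form (binormal_pair \<mu>1 \<Sigma>1 \<mu>2 \<Sigma>2) node_form"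
proof -
  let ?Q1 = "quad \<mu>1 (matrix_inv \<Sigma>1)" and ?Q2 = "quad \<mu>2 (matrix_inv \<Sigma>2)"
  let ?Q = "\<lambda>x. vector [?Q1 x, ?Q2 x] :: real^2"
  {
    assume nz: "\<alpha> \<noteq> 0" "\<beta> \<noteq> 0"
    \<comment> \<open>Substituting sX and tY for the two affine forms requires \<beta> t = s^2 and
      \<alpha> s = t^2; eliminating t leaves s^3 = \<alpha> \<beta>^2, solvable by a real cube root
      whatever the signs.\<close>
    define s where "s = root 3 (\<alpha> * \<beta>\<^sup>2)"
    define t where "t = s\<^sup>2 / \<beta>"
    have s3: "s ^ 3 = \<alpha> * \<beta>\<^sup>2" by (simp add: s_def odd_real_root_pow)
    have st: "s \<noteq> 0" "t \<noteq> 0" using nz by (auto simp: s_def t_def)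
    have \<beta>t: "\<beta> * t = s\<^sup>2" using nz by (simp add: t_def)
    have "t\<^sup>2 * \<beta>\<^sup>2 = \<alpha> * s * \<beta>\<^sup>2" using \<beta>t s3 by algebra
    then have \<alpha>s: "\<alpha> * s = t\<^sup>2" using nz by simp
    have det: "(- l1 / s\<^sup>2) * (- 1 / t\<^sup>2) - (1 / s\<^sup>2) * (l2 / t\<^sup>2) \<noteq> 0"
      using l st by (simp add: divide_simps)
    show "affine_normal_form (binormal_pair \<mu>1 \<Sigma>1 \<mu>2 \<Sigma>2) cusp_form"
    proof (rule affine_normal_form_binormal_pairI[OF \<Sigma>
          affine_diffeomorphism[OF det, of "- c1 / s\<^sup>2" "- c2 / t\<^sup>2"],
          of "n /\<^sub>R s" "m /\<^sub>R t" _ _ _ "e / s" "f / t"])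
      show "(n /\<^sub>R s) $ 1 * (m /\<^sub>R t) $ 2 - (n /\<^sub>R s) $ 2 * (m /\<^sub>R t) $ 1 \<noteq> 0"
        using nm st by (simp add: field_simps)
      fix x
      define X Y where "X = (n \<bullet> x + e) / s" and "Y = (m \<bullet> x + f) / t"
      have "n \<bullet> x + e = s * X" "m \<bullet> x + f = t * Y" using st by (simp_all add: X_def Y_def)
      then have "?Q2 x - l1 * ?Q1 x - c1 = s\<^sup>2 * (X\<^sup>2 + Y)" "l2 * ?Q1 x - ?Q2 x - c2 = t\<^sup>2 * (Y\<^sup>2 + X)"
        using U[of x] V[of x] \<beta>t \<alpha>s by algebra+
      then have "(?Q2 x - l1 * ?Q1 x - c1) / s\<^sup>2 = X\<^sup>2 + Y" "(l2 * ?Q1 x - ?Q2 x - c2) / t\<^sup>2 = Y\<^sup>2 + X"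
        using st by simp_all
      moreover have "(n /\<^sub>R s) \<bullet> x + e / s = X" "(m /\<^sub>R t) \<bullet> x + f / t = Y"
        by (simp_all add: X_def Y_def divide_inverse algebra_simps)
      ultimately show "vector [- l1 / s\<^sup>2 * ?Q x $ 1 + 1 / s\<^sup>2 * ?Q x $ 2 + - c1 / s\<^sup>2,
            l2 / t\<^sup>2 * ?Q x $ 1 + - 1 / t\<^sup>2 * ?Q x $ 2 + - c2 / t\<^sup>2] =
          cusp_form (vector [(n /\<^sub>R s) \<bullet> x + e / s, (m /\<^sub>R t) \<bullet> x + f / t])"
        by (simp add: cusp_form_def diff_divide_distrib)
    qed
  next
    assume \<alpha>: "\<alpha> \<noteq> 0" "\<beta> = 0"
    \<comment> \<open>Scaling the first form by \<alpha> absorbs the cross coefficient; its square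
      then carries the factor \<alpha>^2.\<close>
    have det: "(- l1 * \<alpha>\<^sup>2) * (- 1) - \<alpha>\<^sup>2 * l2 \<noteq> 0" using l \<alpha>(1) by simp
    show "affine_normal_form (binormal_pair \<mu>1 \<Sigma>1 \<mu>2 \<Sigma>2) node_form"
    proof (rule affine_normal_form_binormal_pairI[OF \<Sigma>
          affine_diffeomorphism[OF det, of "- c1 * \<alpha>\<^sup>2" "- c2"],
          of "\<alpha> *\<^sub>R n" m _ _ _ "\<alpha> * e" f])
      show "(\<alpha> *\<^sub>R n) $ 1 * m $ 2 - (\<alpha> *\<^sub>R n) $ 2 * m $ 1 \<noteq> 0"
        using nm \<alpha>(1) by (simp add: algebra_simps)
      fix x
      have "- l1 * \<alpha>\<^sup>2 * ?Q1 x + \<alpha>\<^sup>2 * ?Q2 x + - c1 * \<alpha>\<^sup>2 = (\<alpha> * (n \<bullet> x) + \<alpha> * e)\<^sup>2"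
        "l2 * ?Q1 x + - 1 * ?Q2 x + - c2 = (m \<bullet> x + f)\<^sup>2 + (\<alpha> * (n \<bullet> x) + \<alpha> * e)"
        using U[of x] V[of x] \<alpha>(2) by algebra+
      then show "vector [- l1 * \<alpha>\<^sup>2 * ?Q x $ 1 + \<alpha>\<^sup>2 * ?Q x $ 2 + - c1 * \<alpha>\<^sup>2,
            l2 * ?Q x $ 1 + - 1 * ?Q x $ 2 + - c2] =
          node_form (vector [(\<alpha> *\<^sub>R n) \<bullet> x + \<alpha> * e, m \<bullet> x + f])"
        by (simp add: node_form_def)
    qed
  next
    assume \<beta>: "\<alpha> = 0" "\<beta> \<noteq> 0"
    \<comment> \<open>As in the previous case with the two forms, and the two target coordinates,
      exchanged.\<close>
    have det: "(l2 * \<beta>\<^sup>2) * 1 - (- \<beta>\<^sup>2) * (- l1) \<noteq> 0" using l \<beta>(2) by simp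
    show "affine_normal_form (binormal_pair \<mu>1 \<Sigma>1 \<mu>2 \<Sigma>2) node_form"
    proof (rule affine_normal_form_binormal_pairI[OF \<Sigma>
          affine_diffeomorphism[OF det, of "- c2 * \<beta>\<^sup>2" "- c1"],
          of "\<beta> *\<^sub>R m" n _ _ _ "\<beta> * f" e])
      show "(\<beta> *\<^sub>R m) $ 1 * n $ 2 - (\<beta> *\<^sub>R m) $ 2 * n $ 1 \<noteq> 0"
        using nm \<beta>(2) by (simp add: algebra_simps)
      fix x
      have "l2 * \<beta>\<^sup>2 * ?Q1 x + - \<beta>\<^sup>2 * ?Q2 x + - c2 * \<beta>\<^sup>2 = (\<beta> * (m \<bullet> x) + \<beta> * f)\<^sup>2"
        "- l1 * ?Q1 x + 1 * ?Q2 x + - c1 = (n \<bullet> x + e)\<^sup>2 + (\<beta> * (m \<bullet> x) + \<beta> * f)"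
        using U[of x] V[of x] \<beta>(1) by algebra+
      then show "vector [l2 * \<beta>\<^sup>2 * ?Q x $ 1 + - \<beta>\<^sup>2 * ?Q x $ 2 + - c2 * \<beta>\<^sup>2,
            - l1 * ?Q x $ 1 + 1 * ?Q x $ 2 + - c1] =
          node_form (vector [(\<beta> *\<^sub>R m) \<bullet> x + \<beta> * f, n \<bullet> x + e])"
        by (simp add: node_form_def)
    qed
  }
qed

text \<open>With proportional forms Q2/l - Q1 is affine, and nonconstant because the means differ.
  It provides the coordinate X; relative to X, Q1 is a constant multiple of the square of a second
  coordinate plus a function of X, which the target can subtract.\<close>

lemma affine_normal_form_fold_model:
  assumes \<Sigma>: "pos_def_sym \<Sigma>1" "pos_def_sym \<Sigma>2" and \<mu>: "\<mu>1 \<noteq> \<mu>2"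
    and proportional: "matrix_inv \<Sigma>2 = l *\<^sub>R matrix_inv \<Sigma>1"
  shows "affine_normal_form (binormal_pair \<mu>1 \<Sigma>1 \<mu>2 \<Sigma>2) fold_model"
proof -
  define A where "A = matrix_inv \<Sigma>1"
  define D where "D = A $ 1 $ 1 * A $ 2 $ 2 - A $ 1 $ 2 * A $ 1 $ 2"
  define d where "d = \<mu>2 - \<mu>1"
  define S where "S = d \<bullet> (A *v d)"
  define m :: "real^2" where "m = vector [- d $ 2, d $ 1]"
  let ?Q1 = "quad \<mu>1 (matrix_inv \<Sigma>1)" and ?Q2 = "quad \<mu>2 (matrix_inv \<Sigma>2)"
  have A: "pos_def_sym A" "A $ 1 $ 2 = A $ 2 $ 1" "D > 0"
    using pos_def_sym_matrix_inv(1)[OF \<Sigma>(1)] by (auto simp: A_def D_def pos_def_sym_iff)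
  have S: "S > 0" using A(1) \<mu> by (auto simp: S_def d_def pos_def_sym_def)
  have l: "l \<noteq> 0"
  proof
    assume "l = 0"
    then have "matrix_inv \<Sigma>2 $ 1 $ 1 = 0" using proportional by simp
    then show False using pos_def_sym_matrix_inv(1)[OF \<Sigma>(2)] by (simp add: pos_def_sym_iff)
  qed
  define X W where "X = (\<lambda>x. (A *v d) \<bullet> x + - ((A *v d) \<bullet> \<mu>1))"
    and "W = (\<lambda>x. m \<bullet> x + - (m \<bullet> \<mu>1))"
  \<comment> \<open>Lagrange's identity for the inner product defined by A: \<open>W\<close> is the
    determinant of d and x - \<open>\<mu>1\<close>, and \<open>D\<close> is det A.\<close>
  have Q1: "S * ?Q1 x = (X x)\<^sup>2 + D * (W x)\<^sup>2" for x
    using A(2) unfolding S_def X_def W_def D_def quad_def A_def[symmetric] m_def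
    by (simp add: inner_vec_def matrix_vector_mult_def sum_2 power2_eq_square algebra_simps)
  have Q2: "?Q2 x = l * (?Q1 x - 2 * X x + S)" for x
    using A(2) unfolding S_def X_def quad_def proportional A_def[symmetric] d_def
    by (simp add: inner_vec_def matrix_vector_mult_def sum_2 power2_eq_square algebra_simps)
  let ?\<Psi> = "\<lambda>z::real^2. vector [(z $ 1 + S - z $ 2 / l) / 2,
    (S * z $ 1 - ((z $ 1 + S - z $ 2 / l) / 2)\<^sup>2) / D] :: real^2"
  let ?E = "\<lambda>z::real^2. vector [(D * z $ 2 + (z $ 1)\<^sup>2) / S,
    l * ((D * z $ 2 + (z $ 1)\<^sup>2) / S - 2 * z $ 1 + S)] :: real^2"
  have "diffeomorphism UNIV UNIV ?\<Psi>"
  proof (rule diffeomorphismI[where g = ?E])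
    show "smooth_on UNIV ?\<Psi>" by (intro smooth_intros open_UNIV) (use A l in simp_all)
    show "smooth_on UNIV ?E" by (intro smooth_intros open_UNIV) (use S in simp_all)
    show "?E (?\<Psi> z) = z" for z
    proof -
      have "(D * ?\<Psi> z $ 2 + (?\<Psi> z $ 1)\<^sup>2) / S = z $ 1" using A(3) S by simp
      moreover have "l * (z $ 1 - 2 * ?\<Psi> z $ 1 + S) = z $ 2" using l by (simp add: field_simps)
      ultimately show ?thesis by (simp only: vec_eq_iff forall_2 vector_2 simp_thms)
    qed
    show "?\<Psi> (?E z) = z" for z
    proof -
      have "(?E z $ 1 + S - ?E z $ 2 / l) / 2 = z $ 1" using l by simp
      moreover have "(S * ?E z $ 1 - (z $ 1)\<^sup>2) / D = z $ 2" using A(3) S by simp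
      ultimately show ?thesis by (simp only: vec_eq_iff forall_2 vector_2 simp_thms)
    qed
  qed simp_all
  then show ?thesis
  proof (rule affine_normal_form_binormal_pairI[OF \<Sigma>, of _ "A *v d" m])
    have "(A *v d) $ 1 * m $ 2 - (A *v d) $ 2 * m $ 1 = S"
      by (simp add: m_def S_def inner_vec_def sum_2)
    then show "(A *v d) $ 1 * m $ 2 - (A *v d) $ 2 * m $ 1 \<noteq> 0" using S by simp
    fix x
    have XW: "(A *v d) \<bullet> x + - ((A *v d) \<bullet> \<mu>1) = X x" "m \<bullet> x + - (m \<bullet> \<mu>1) = W x"
      by (simp_all only: X_def W_def)
    have "(?Q1 x + S - ?Q2 x / l) / 2 = X x" using l by (simp add: Q2)
    moreover have "(S * ?Q1 x - (X x)\<^sup>2) / D = (W x)\<^sup>2" using A(3) by (simp add: Q1)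
    ultimately show "?\<Psi> (vector [?Q1 x, ?Q2 x]) =
        fold_model (vector [(A *v d) \<bullet> x + - ((A *v d) \<bullet> \<mu>1), m \<bullet> x + - (m \<bullet> \<mu>1)])"
      by (simp only: XW fold_model_def vector_2)
  qed
qed

text \<open>A degenerate semidefinite binary form is the square of a linear form; the second
  coefficient carries the sign of f.\<close>

lemma rank_one_quadratic_form:
  fixes e f g :: real
  assumes "e \<ge> 0" "g \<ge> 0" "e * g = f\<^sup>2"
  obtains n :: "real^2" where "e = (n $ 1)\<^sup>2" "f = n $ 1 * n $ 2" "g = (n $ 2)\<^sup>2"
proof -
  define s where "s = (if f \<ge> 0 then 1 else - 1 :: real)"
  have "sqrt e * sqrt g = \<bar>f\<bar>" using assms by (metis real_sqrt_mult real_sqrt_abs)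
  then have "f = sqrt e * (s * sqrt g)" by (auto simp: s_def)
  moreover have "(s * sqrt g)\<^sup>2 = g" using assms by (simp add: s_def power_mult_distrib)
  ultimately show thesis using that[of "vector [sqrt e, s * sqrt g]"] assms by simp
qed

text \<open>The characteristic polynomial of the pencil is nonpositive at \<open>a2 / a1\<close> and at \<open>c2 / c1\<close>; these
  ratios therefore lie between its roots.\<close>

lemma quadratic_pencil:
  fixes a1 b1 c1 a2 b2 c2 :: real
  assumes "a1 > 0" "a1 * c1 > b1\<^sup>2"
  shows "(\<exists>l. a2 = l * a1 \<and> b2 = l * b1 \<and> c2 = l * c1) \<or>
    (\<exists>l1 l2 (n::real^2) (m::real^2). l1 < l2 \<and>
      a2 - l1 * a1 = (n $ 1)\<^sup>2 \<and> b2 - l1 * b1 = n $ 1 * n $ 2 \<and> c2 - l1 * c1 = (n $ 2)\<^sup>2 \<and>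
      l2 * a1 - a2 = (m $ 1)\<^sup>2 \<and> l2 * b1 - b2 = m $ 1 * m $ 2 \<and> l2 * c1 - c2 = (m $ 2)\<^sup>2 \<and>
      n $ 1 * m $ 2 - n $ 2 * m $ 1 \<noteq> (0::real))"
proof -
  \<comment> \<open>Here p(l) = D l^2 - T l + E is the characteristic polynomial of the pencil, and
    \<open>R\<close> is its discriminant.\<close>
  define D T E where "D = a1 * c1 - b1\<^sup>2" and "T = a1 * c2 + a2 * c1 - 2 * b1 * b2"
    and "E = a2 * c2 - b2\<^sup>2"
  define p where "p = (\<lambda>l. (a2 - l * a1) * (c2 - l * c1) - (b2 - l * b1)\<^sup>2)"
  define R where "R = T\<^sup>2 - 4 * D * E"
  have D: "D > 0" using assms by (simp add: D_def)
  have "a1 * c1 > 0" using assms by (meson le_less_trans zero_le_power2)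
  then have c1: "c1 > 0" using assms(1) by (simp add: zero_less_mult_iff)
  have square: "4 * D * p l = (2 * D * l - T)\<^sup>2 - R" for l
    unfolding p_def R_def D_def T_def E_def by algebra
  have le: "(2 * D * l - T)\<^sup>2 \<le> R" if "p l \<le> 0" for l
    using square[of l] D that by (smt (verit) mult_nonneg_nonpos)
  have pa: "p (a2 / a1) \<le> 0" and pc: "p (c2 / c1) \<le> 0"
    using assms(1) c1 by (simp_all add: p_def)
  have R: "R \<ge> 0" using le[OF pa] by (smt (verit) zero_le_power2)
  define l1 l2 where "l1 = (T - sqrt R) / (2 * D)" and "l2 = (T + sqrt R) / (2 * D)"
  have root: "p l1 = 0" "p l2 = 0"
  proof -
    have "2 * D * l1 - T = - sqrt R" "2 * D * l2 - T = sqrt R"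
      using D by (simp_all add: l1_def l2_def)
    then have "4 * D * p l1 = 0" "4 * D * p l2 = 0" using square[of l1] square[of l2] R by simp_all
    then show "p l1 = 0" "p l2 = 0" using D by simp_all
  qed
  have between: "l1 \<le> l \<and> l \<le> l2" if "p l \<le> 0" for l
  proof -
    have "\<bar>2 * D * l - T\<bar> \<le> sqrt R" using le[OF that] by (metis real_sqrt_abs real_sqrt_le_mono)
    then have "T - sqrt R \<le> 2 * D * l" "2 * D * l \<le> T + sqrt R" by auto
    then show ?thesis using D by (simp add: l1_def l2_def divide_le_eq le_divide_eq mult_ac)
  qed
  have sgn: "a2 - l1 * a1 \<ge> 0" "c2 - l1 * c1 \<ge> 0" "l2 * a1 - a2 \<ge> 0" "l2 * c1 - c2 \<ge> 0"
    using between[OF pa] between[OF pc] assms(1) c1 by (simp_all add: le_divide_eq divide_le_eq)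
  have prod: "(a2 - l1 * a1) * (c2 - l1 * c1) = (b2 - l1 * b1)\<^sup>2"
    "(l2 * a1 - a2) * (l2 * c1 - c2) = (l2 * b1 - b2)\<^sup>2"
    using root unfolding p_def by algebra+
  show ?thesis
  proof (cases "l1 = l2")
    \<comment> \<open>With a double root the inequalities in \<open>sgn\<close> hold in both
      directions, so the form at the root is zero.\<close>
    case True
    then have "a2 = l1 * a1" "c2 = l1 * c1" using sgn by auto
    moreover from this have "b2 = l1 * b1" using prod(1) by simp
    ultimately show ?thesis by blast
  next
    case False
    then have l: "l1 < l2" using between[OF pa] by simp
    obtain n :: "real^2" where n: "a2 - l1 * a1 = (n $ 1)\<^sup>2" "b2 - l1 * b1 = n $ 1 * n $ 2"
      "c2 - l1 * c1 = (n $ 2)\<^sup>2"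
      using rank_one_quadratic_form[OF sgn(1,2) prod(1)] .
    obtain m :: "real^2" where m: "l2 * a1 - a2 = (m $ 1)\<^sup>2" "l2 * b1 - b2 = m $ 1 * m $ 2"
      "l2 * c1 - c2 = (m $ 2)\<^sup>2"
      using rank_one_quadratic_form[OF sgn(3,4) prod(2)] .
    \<comment> \<open>Adding the two rank-one forms gives (l2 - l1) times the first form; this
      compares determinants.\<close>
    have "(n $ 1 * m $ 2 - n $ 2 * m $ 1)\<^sup>2 = (l2 - l1)\<^sup>2 * D"
      using n m unfolding D_def by algebra
    then have "n $ 1 * m $ 2 - n $ 2 * m $ 1 \<noteq> 0" using l D by auto
    then show ?thesis using l n m by blast
  qed
qed

section \<open>Completing the squares\<close>

lemma quad_eq_0_iff: "pos_def_sym A \<Longrightarrow> quad \<mu> A x = 0 \<longleftrightarrow> x = \<mu>"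
  unfolding quad_def pos_def_sym_def by (metis eq_iff_diff_eq_0 inner_zero_left less_irrefl)

lemma linear_form_basis:
  fixes n m :: "real^2" and p q :: real
  assumes nm: "n $ 1 * m $ 2 - n $ 2 * m $ 1 \<noteq> 0"
  obtains r s where "\<And>x::real^2. p * x $ 1 + q * x $ 2 = r * (n \<bullet> x) + s * (m \<bullet> x)"
proof -
  let ?d = "n $ 1 * m $ 2 - n $ 2 * m $ 1"
  define r s where "r = (p * m $ 2 - q * m $ 1) / ?d" and "s = (q * n $ 1 - p * n $ 2) / ?d"
  have "r * ?d = p * m $ 2 - q * m $ 1" "s * ?d = q * n $ 1 - p * n $ 2"
    using nm by (simp_all add: r_def s_def)
  then have "?d * (r * n $ 1 + s * m $ 1) = ?d * p" "?d * (r * n $ 2 + s * m $ 2) = ?d * q"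
    by algebra+
  then have pq: "p = r * n $ 1 + s * m $ 1" "q = r * n $ 2 + s * m $ 2"
    using nm by simp_all
  have "p * x $ 1 + q * x $ 2 = r * (n \<bullet> x) + s * (m \<bullet> x)" for x
    unfolding pq by (simp add: inner_vec_def sum_2 algebra_simps)
  then show thesis by (rule that)
qed

lemma common_zero:
  fixes n m :: "real^2"
  assumes nm: "n $ 1 * m $ 2 - n $ 2 * m $ 1 \<noteq> 0"
  obtains z where "n \<bullet> z + e = 0" "m \<bullet> z + f = 0"
proof -
  let ?d = "n $ 1 * m $ 2 - n $ 2 * m $ 1"
  let ?z = "vector [(n $ 2 * f - m $ 2 * e) / ?d, (m $ 1 * e - n $ 1 * f) / ?d] :: real^2"
  have "?d * (n \<bullet> ?z + e) = 0" "?d * (m \<bullet> ?z + f) = 0"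
    using nm by (simp_all add: inner_vec_def sum_2 distrib_left) (simp_all add: algebra_simps)
  then show thesis using nm that[of ?z] by simp
qed

lemma quad_expand:
  assumes "pos_def_sym A"
  shows "quad \<mu> A x = A $ 1 $ 1 * (x $ 1)\<^sup>2 + 2 * A $ 1 $ 2 * x $ 1 * x $ 2 + A $ 2 $ 2 * (x $ 2)\<^sup>2
    + (- 2 * (A $ 1 $ 1 * \<mu> $ 1 + A $ 1 $ 2 * \<mu> $ 2)) * x $ 1
    + (- 2 * (A $ 1 $ 2 * \<mu> $ 1 + A $ 2 $ 2 * \<mu> $ 2)) * x $ 2 + quad \<mu> A 0"
  using assms unfolding quad_def
  by (simp add: pos_def_sym_iff inner_vec_def matrix_vector_mult_def sum_2 power2_eq_square
      algebra_simps)

lemma affine_normal_form_cases: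
  assumes \<Sigma>: "pos_def_sym \<Sigma>1" "pos_def_sym \<Sigma>2" and \<mu>: "\<mu>1 \<noteq> \<mu>2"
  shows "affine_normal_form (binormal_pair \<mu>1 \<Sigma>1 \<mu>2 \<Sigma>2) cusp_form \<or>
    affine_normal_form (binormal_pair \<mu>1 \<Sigma>1 \<mu>2 \<Sigma>2) node_form \<or>
    affine_normal_form (binormal_pair \<mu>1 \<Sigma>1 \<mu>2 \<Sigma>2) fold_model"
proof -
  define A B where "A = matrix_inv \<Sigma>1" and "B = matrix_inv \<Sigma>2"
  have A: "pos_def_sym A" and B: "pos_def_sym B"
    using \<Sigma> by (simp_all add: A_def B_def pos_def_sym_matrix_inv)
  have "A $ 1 $ 1 > 0" "A $ 1 $ 1 * A $ 2 $ 2 > (A $ 1 $ 2)\<^sup>2"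
    using A by (auto simp: pos_def_sym_iff power2_eq_square)
  from quadratic_pencil[OF this, of "B $ 1 $ 1" "B $ 1 $ 2" "B $ 2 $ 2"]
  consider (proportional) l where "B $ 1 $ 1 = l * A $ 1 $ 1" "B $ 1 $ 2 = l * A $ 1 $ 2" "B $ 2 $ 2 = l * A $ 2 $ 2"
    | (pencil) l1 l2 and n m :: "real^2" where "l1 < l2"
      "B $ 1 $ 1 - l1 * A $ 1 $ 1 = (n $ 1)\<^sup>2" "B $ 1 $ 2 - l1 * A $ 1 $ 2 = n $ 1 * n $ 2"
      "B $ 2 $ 2 - l1 * A $ 2 $ 2 = (n $ 2)\<^sup>2"
      "l2 * A $ 1 $ 1 - B $ 1 $ 1 = (m $ 1)\<^sup>2" "l2 * A $ 1 $ 2 - B $ 1 $ 2 = m $ 1 * m $ 2"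
      "l2 * A $ 2 $ 2 - B $ 2 $ 2 = (m $ 2)\<^sup>2"
      "n $ 1 * m $ 2 - n $ 2 * m $ 1 \<noteq> (0::real)"
    by blast
  then show ?thesis
  proof cases
    case proportional
    then have "B = l *\<^sub>R A"
      using A B by (simp add: vec_eq_iff forall_2 pos_def_sym_iff)
    then show ?thesis
      using affine_normal_form_fold_model[OF \<Sigma> \<mu>] unfolding A_def B_def by blast
  next
    case pencil
    let ?Q1 = "quad \<mu>1 A" and ?Q2 = "quad \<mu>2 B"
    define d1 e1 d2 e2 where "d1 = - 2 * (A $ 1 $ 1 * \<mu>1 $ 1 + A $ 1 $ 2 * \<mu>1 $ 2)"
      and "e1 = - 2 * (A $ 1 $ 2 * \<mu>1 $ 1 + A $ 2 $ 2 * \<mu>1 $ 2)"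
      and "d2 = - 2 * (B $ 1 $ 1 * \<mu>2 $ 1 + B $ 1 $ 2 * \<mu>2 $ 2)"
      and "e2 = - 2 * (B $ 1 $ 2 * \<mu>2 $ 1 + B $ 2 $ 2 * \<mu>2 $ 2)"
    note Q = quad_expand[OF A, of \<mu>1, folded d1_def e1_def] quad_expand[OF B, of \<mu>2, folded d2_def e2_def]
    \<comment> \<open>The linear parts are expanded in the basis n, m. The coefficients r and s are
      absorbed by completing the squares; \<alpha> and \<beta> belong to the form that is not
      squared and cannot be removed.\<close>
    obtain r \<beta> where r: "\<And>x::real^2. (d2 - l1 * d1) * x $ 1 + (e2 - l1 * e1) * x $ 2 =
        r * (n \<bullet> x) + \<beta> * (m \<bullet> x)"
      using linear_form_basis[OF pencil(8)] by blast
    obtain \<alpha> s where s: "\<And>x::real^2. (l2 * d1 - d2) * x $ 1 + (l2 * e1 - e2) * x $ 2 =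
        \<alpha> * (n \<bullet> x) + s * (m \<bullet> x)"
      using linear_form_basis[OF pencil(8)] by blast
    define c1 c2 where "c1 = ?Q2 0 - l1 * ?Q1 0 - r\<^sup>2 / 4 - \<beta> * (s / 2)"
      and "c2 = l2 * ?Q1 0 - ?Q2 0 - s\<^sup>2 / 4 - \<alpha> * (r / 2)"
    have inner: "n \<bullet> x = n $ 1 * x $ 1 + n $ 2 * x $ 2" "m \<bullet> x = m $ 1 * x $ 1 + m $ 2 * x $ 2" for x
      by (simp_all add: inner_vec_def sum_2)
    have U: "?Q2 x - l1 * ?Q1 x = (n \<bullet> x + r / 2)\<^sup>2 + \<beta> * (m \<bullet> x + s / 2) + c1" for x
    proof -
      have "?Q2 x - l1 * ?Q1 x = (n \<bullet> x)\<^sup>2 +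
          ((d2 - l1 * d1) * x $ 1 + (e2 - l1 * e1) * x $ 2) + (?Q2 0 - l1 * ?Q1 0)"
        unfolding Q[of x] inner using pencil(2-4) by algebra
      then show ?thesis unfolding r c1_def by (simp add: power2_eq_square field_simps)
    qed
    have V: "l2 * ?Q1 x - ?Q2 x = (m \<bullet> x + s / 2)\<^sup>2 + \<alpha> * (n \<bullet> x + r / 2) + c2" for x
    proof -
      have "l2 * ?Q1 x - ?Q2 x = (m \<bullet> x)\<^sup>2 +
          ((l2 * d1 - d2) * x $ 1 + (l2 * e1 - e2) * x $ 2) + (l2 * ?Q1 0 - ?Q2 0)"
        unfolding Q[of x] inner using pencil(5-7) by algebra
      then show ?thesis unfolding s c2_def by (simp add: power2_eq_square field_simps)
    qed
    have "\<not> (\<alpha> = 0 \<and> \<beta> = 0)"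
    proof
      assume zero: "\<alpha> = 0 \<and> \<beta> = 0"
      obtain z where z: "n \<bullet> z + r / 2 = 0" "m \<bullet> z + s / 2 = 0"
        using common_zero[OF pencil(8)] .
      \<comment> \<open>Both quadratic functions are symmetric about \<open>z\<close>, which must then be the centre of each.\<close>
      have zh: "n \<bullet> (z + h) + r / 2 = n \<bullet> h" "m \<bullet> (z + h) + s / 2 = m \<bullet> h" for h
        using z by (simp_all add: inner_add_right)
      have UV: "?Q2 (z + h) - l1 * ?Q1 (z + h) = ?Q2 (z + - h) - l1 * ?Q1 (z + - h)"
        "l2 * ?Q1 (z + h) - ?Q2 (z + h) = l2 * ?Q1 (z + - h) - ?Q2 (z + - h)" for h
        unfolding U V zh using zero by simp_all
      have "(l2 - l1) * ?Q1 (z + h) = (l2 - l1) * ?Q1 (z + - h)" for h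
        unfolding left_diff_distrib using UV[of h] by linarith
      then have sym1: "?Q1 (z + h) = ?Q1 (z + - h)" for h
        using pencil(1) by (metis mult_left_cancel less_irrefl right_minus_eq)
      have sym2: "?Q2 (z + h) = ?Q2 (z + - h)" for h
        using UV(1)[of h] sym1[of h] by simp
      have "z = \<mu>" if "\<And>h. quad \<mu> C (z + h) = quad \<mu> C (z + - h)" "pos_def_sym C" for \<mu> C
      proof -
        \<comment> \<open>The offset is chosen so that the reflected point is \<mu> itself; the form
          therefore vanishes at 2z - \<mu> too, and \<mu> is its only zero.\<close>
        have "quad \<mu> C (z + (z - \<mu>)) = 0"
          using that(1)[of "z - \<mu>"] quad_eq_0_iff[OF that(2), of \<mu> \<mu>] by simp
        then have "2 *\<^sub>R z = 2 *\<^sub>R \<mu>"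
          using quad_eq_0_iff[OF that(2)] by (simp add: scaleR_2 algebra_simps)
        then show ?thesis by simp
      qed
      from this[OF sym1 A] this[OF sym2 B] show False using \<mu> by simp
    qed
    then show ?thesis
      using affine_normal_form_of_pencil[OF \<Sigma> less_imp_neq[OF pencil(1)] pencil(8),
          of \<mu>2 \<mu>1 "r / 2" \<beta> "s / 2" c1 \<alpha> c2, folded A_def B_def, OF U V]
      by blast
  qed
qed

section \<open>The classification\<close>

lemma binormal_pairs_cases:
  assumes "F \<in> binormal_pairs"
  shows "affine_normal_form F cusp_form \<or> affine_normal_form F node_form \<or>
    affine_normal_form F fold_model"
  using assms affine_normal_form_cases unfolding binormal_pairs_def by blast

text \<open>Each normal form implies its type, one of the normal forms always occurs, and the types
  exclude each other; so the implications reverse.\<close>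

lemma type_iff_affine_normal_form:
  assumes "F \<in> binormal_pairs"
  shows "type1 F \<longleftrightarrow> affine_normal_form F cusp_form"
    and "type2 F \<longleftrightarrow> affine_normal_form F node_form"
    and "type3 F \<longleftrightarrow> affine_normal_form F fold_model"
  using binormal_pairs_cases[OF assms] types_exclusive[of F] type1_if_cusp_form[of F]
    type2_if_node_form[of F] type3_if_fold_model[of F] by blast+

lemma A_rel_if_same_normal_form:
  assumes "F \<in> binormal_pairs" "F' \<in> binormal_pairs" "smooth_on UNIV G"
    and "affine_normal_form F G" "affine_normal_form F' G"
  shows "(F, F') \<in> A_rel"
  using assms A_equivalent_trans A_equivalent_sym affine_normal_form_A_equivalent
  unfolding A_rel_def by blast

lemma A_equivalent_normal_forms:
  assumes "(F, F') \<in> A_rel" "smooth_on UNIV G" "smooth_on UNIV G'"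
    and "affine_normal_form F G" "affine_normal_form F' G'"
  shows "A_equivalent UNIV UNIV G UNIV UNIV G'"
proof -
  have "A_equivalent UNIV UNIV G UNIV pos_quadrant F"
    using affine_normal_form_A_equivalent[OF assms(4,2)] by (rule A_equivalent_sym)
  moreover have "A_equivalent UNIV pos_quadrant F UNIV pos_quadrant F'"
    using assms(1) by (simp add: A_rel_def)
  moreover have "A_equivalent UNIV pos_quadrant F' UNIV UNIV G'"
    by (rule affine_normal_form_A_equivalent[OF assms(5,3)])
  ultimately show ?thesis by (blast intro: A_equivalent_trans)
qed

text \<open>Being a hyperbola is not a property that diffeomorphisms preserve, so the invariance of
  the types is obtained through the normal forms and their inequivalence.\<close>

lemma A_rel_iff_same_type:
  assumes "F \<in> binormal_pairs" "F' \<in> binormal_pairs"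
  shows "(F, F') \<in> A_rel \<longleftrightarrow> type1 F \<and> type1 F' \<or> type2 F \<and> type2 F' \<or> type3 F \<and> type3 F'"
proof
  assume rel: "(F, F') \<in> A_rel"
  note forms = A_equivalent_normal_forms[OF rel]
  have not_sym: "\<not> A_equivalent UNIV UNIV fold_model UNIV UNIV node_form"
    "\<not> A_equivalent UNIV UNIV node_form UNIV UNIV fold_model"
    using not_A_equivalent_node_model_fold_model A_equivalent_node_form_node_model
    by (meson A_equivalent_sym A_equivalent_trans)+
  show "type1 F \<and> type1 F' \<or> type2 F \<and> type2 F' \<or> type3 F \<and> type3 F'"
    unfolding type_iff_affine_normal_form[OF assms(1)] type_iff_affine_normal_form[OF assms(2)]
    using binormal_pairs_cases[OF assms(1)] binormal_pairs_cases[OF assms(2)] not_sym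
      forms[OF smooth_cusp_form smooth_node_form] forms[OF smooth_node_form smooth_cusp_form]
      forms[OF smooth_cusp_form smooth_fold_model] forms[OF smooth_fold_model smooth_cusp_form]
      forms[OF smooth_node_form smooth_fold_model] forms[OF smooth_fold_model smooth_node_form]
      not_A_equivalent_cusp_form_fold_model not_A_equivalent_node_form_cusp_form
      A_equivalent_sym
    by metis
next
  assume "type1 F \<and> type1 F' \<or> type2 F \<and> type2 F' \<or> type3 F \<and> type3 F'"
  then show "(F, F') \<in> A_rel"
    using A_rel_if_same_normal_form[OF assms] smooth_cusp_form smooth_node_form smooth_fold_model
    unfolding type_iff_affine_normal_form[OF assms(1)] type_iff_affine_normal_form[OF assms(2)]
    by blast
qed

lemma exists_type1_type2:
  "\<exists>F\<in>binormal_pairs. type1 F" "\<exists>F\<in>binormal_pairs. type2 F"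
proof -
  \<comment> \<open>With inverse covariance matrices 1 and diag(3, 2) the pencil has roots 2 and 3
    and the coordinate axes as eigenvectors. Means 0 and (1, q) give \<alpha> = 6 and \<beta> = -4q,
    so q alone decides between the cusp and the node.\<close>
  define B :: "real^2^2" where "B = vector [vector [3, 0], vector [0, 2]]"
  define \<Sigma>1 \<Sigma>2 where "\<Sigma>1 = matrix_inv (mat 1 :: real^2^2)" and "\<Sigma>2 = matrix_inv B"
  have pd: "pos_def_sym (mat 1 :: real^2^2)" "pos_def_sym B"
    by (simp_all add: pos_def_sym_iff mat_def B_def)
  have \<Sigma>: "pos_def_sym \<Sigma>1" "pos_def_sym \<Sigma>2" and inv: "matrix_inv \<Sigma>1 = mat 1" "matrix_inv \<Sigma>2 = B"
    unfolding \<Sigma>1_def \<Sigma>2_def using pd by (simp_all add: pos_def_sym_matrix_inv)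
  let ?n = "vector [1, 0] :: real^2" and ?m = "vector [0, 1] :: real^2"
  have nm: "?n $ 1 * ?m $ 2 - ?n $ 2 * ?m $ 1 \<noteq> 0" by simp
  define \<mu> :: "real \<Rightarrow> real^2" where "\<mu> = (\<lambda>q. vector [1, q])"
  have U: "quad (\<mu> q) (matrix_inv \<Sigma>2) x - 2 * quad 0 (matrix_inv \<Sigma>1) x =
      (?n \<bullet> x + - 3)\<^sup>2 + (- 4 * q) * (?m \<bullet> x + 2 * q) + (10 * q\<^sup>2 - 6)" for x q
    unfolding inv quad_def B_def \<mu>_def
    by (simp add: inner_vec_def matrix_vector_mult_def sum_2 mat_def power2_eq_square algebra_simps)
  have V: "3 * quad 0 (matrix_inv \<Sigma>1) x - quad (\<mu> q) (matrix_inv \<Sigma>2) x =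
      (?m \<bullet> x + 2 * q)\<^sup>2 + 6 * (?n \<bullet> x + - 3) + (15 - 6 * q\<^sup>2)" for x q
    unfolding inv quad_def B_def \<mu>_def
    by (simp add: inner_vec_def matrix_vector_mult_def sum_2 mat_def power2_eq_square algebra_simps)
  have mem: "binormal_pair 0 \<Sigma>1 (\<mu> q) \<Sigma>2 \<in> binormal_pairs" for q
  proof -
    have "0 \<noteq> \<mu> q" by (simp add: \<mu>_def vec_eq_iff forall_2)
    then show ?thesis using \<Sigma> unfolding binormal_pairs_def by blast
  qed
  note forms = affine_normal_form_of_pencil[OF \<Sigma> _ nm U V]
  have "type1 (binormal_pair 0 \<Sigma>1 (\<mu> 1) \<Sigma>2)"
    using forms(1)[of 1] by (intro type1_if_cusp_form) simp
  then show "\<exists>F\<in>binormal_pairs. type1 F" using mem by blast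
  have "type2 (binormal_pair 0 \<Sigma>1 (\<mu> 0) \<Sigma>2)"
    using forms(2)[of 0] by (intro type2_if_node_form) simp
  then show "\<exists>F\<in>binormal_pairs. type2 F" using mem by blast
qed

lemma exists_type3: "\<exists>F\<in>binormal_pairs. type3 F"
proof -
  have pd: "pos_def_sym (mat 1 :: real^2^2)" by (simp add: pos_def_sym_iff mat_def)
  let ?\<mu> = "vector [1, 0] :: real^2"
  have \<mu>: "0 \<noteq> ?\<mu>" by (simp add: vec_eq_iff forall_2)
  have "type3 (binormal_pair 0 (mat 1) ?\<mu> (mat 1))"
    by (intro type3_if_fold_model affine_normal_form_fold_model[OF pd pd \<mu>, of 1]) simp
  then show ?thesis using pd \<mu> unfolding binormal_pairs_def by blast
qed

theorem corollary3p1: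
  shows "equiv binormal_pairs A_rel \<and>
    card (binormal_pairs // A_rel) = 3 \<and>
    binormal_pairs // A_rel =
      {{F \<in> binormal_pairs. type1 F}, {F \<in> binormal_pairs. type2 F}, {F \<in> binormal_pairs. type3 F}} \<and>
    (\<forall>(\<mu>1::real^2) \<mu>2 (\<Sigma>1::real^2^2) \<Sigma>2.
       pos_def_sym \<Sigma>1 \<and> pos_def_sym \<Sigma>2 \<and> \<mu>1 \<noteq> \<mu>2 \<longrightarrow>
       (let F = binormal_pair \<mu>1 \<Sigma>1 \<mu>2 \<Sigma>2 in type1 F \<or> type2 F \<or> type3 F))"
proof -
  let ?T1 = "{F \<in> binormal_pairs. type1 F}" and ?T2 = "{F \<in> binormal_pairs. type2 F}"
    and ?T3 = "{F \<in> binormal_pairs. type3 F}"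
  have types: "type1 F \<or> type2 F \<or> type3 F" if "F \<in> binormal_pairs" for F
    using binormal_pairs_cases[OF that] type_iff_affine_normal_form[OF that] by blast
  have sub: "A_rel \<subseteq> binormal_pairs \<times> binormal_pairs" by (auto simp: A_rel_def)
  have "equiv binormal_pairs A_rel"
  proof (rule equivI)
    show "refl_on binormal_pairs A_rel"
      by (auto simp: refl_on_def A_rel_iff_same_type dest: types)
    show "sym A_rel"
    proof (rule symI)
      show "(F', F) \<in> A_rel" if "(F, F') \<in> A_rel" for F F'
        using that A_equivalent_sym by (auto simp: A_rel_def)
    qed
    show "trans A_rel"
    proof (rule transI)
      show "(F, F'') \<in> A_rel" if "(F, F') \<in> A_rel" "(F', F'') \<in> A_rel" for F F' F''
        using that A_equivalent_trans by (auto simp: A_rel_def)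
    qed
  qed (rule sub)
  moreover have cl: "A_rel `` {F} = {F' \<in> binormal_pairs. P F'}"
    if "F \<in> binormal_pairs" "P F" "P = type1 \<or> P = type2 \<or> P = type3" for F P
    using that sub types_exclusive[of F]
    by (auto simp: A_rel_iff_same_type)
  have quot: "binormal_pairs // A_rel = {?T1, ?T2, ?T3}"
  proof (intro equalityI subsetI)
    fix C assume "C \<in> binormal_pairs // A_rel"
    then obtain F where F: "F \<in> binormal_pairs" "C = A_rel `` {F}" by (auto elim: quotientE)
    then show "C \<in> {?T1, ?T2, ?T3}"
      using types[OF F(1)] cl[OF F(1), of type1] cl[OF F(1), of type2] cl[OF F(1), of type3] by auto
  next
    fix C assume C: "C \<in> {?T1, ?T2, ?T3}"
    \<comment> \<open>Each type is realized, so all three sets really are classes; since they are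
      also disjoint, they are distinct.\<close>
    obtain F1 F2 F3 where F: "F1 \<in> binormal_pairs" "type1 F1" "F2 \<in> binormal_pairs" "type2 F2"
      "F3 \<in> binormal_pairs" "type3 F3"
      using exists_type1_type2 exists_type3 by blast
    have "?T1 = A_rel `` {F1}" "?T2 = A_rel `` {F2}" "?T3 = A_rel `` {F3}"
      using cl[of F1 type1] cl[of F2 type2] cl[of F3 type3] F by simp_all
    then have "?T1 \<in> binormal_pairs // A_rel" "?T2 \<in> binormal_pairs // A_rel"
      "?T3 \<in> binormal_pairs // A_rel"
      using F(1,3,5) by (auto intro: quotientI)
    then show "C \<in> binormal_pairs // A_rel" using C by blast
  qed
  moreover have "card {?T1, ?T2, ?T3} = 3"
  proof -
    have "?T1 \<noteq> ?T2" "?T1 \<noteq> ?T3" "?T2 \<noteq> ?T3"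
      using exists_type1_type2 exists_type3 types_exclusive by blast+
    then show ?thesis by simp
  qed
  moreover have "type1 F \<or> type2 F \<or> type3 F"
    if "pos_def_sym \<Sigma>1" "pos_def_sym \<Sigma>2" "\<mu>1 \<noteq> \<mu>2" "F = binormal_pair \<mu>1 \<Sigma>1 \<mu>2 \<Sigma>2" for F \<mu>1 \<mu>2 \<Sigma>1 \<Sigma>2
    using that types[of F] unfolding binormal_pairs_def by blast
  ultimately show ?thesis by (simp add: Let_def)
qed

end
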